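(* Let $\mathcal N$ be a signed nonlinear network with $n$ nodes partitioned into $n_B$ boundary and $n_C$ central nodes, $m$ edges, a single negative conductance $I_{l_-}=-k\,g_-(y_{l_-})$ on an edge $l_-$ between nodes $i$ and $j$, and with all other edges linear with fixed positive conductances $R_l^{-1}$, parameterized by the single parameter $\alpha=k$. Let $L_+$ be the Laplacian of the linear resistive network obtained by removing the negative conductance edge. Assume that the graph associated with $L_+$ is connected and let $r_{ij}=v_i-v_j$ with $L_+v=e_{ij}$, $v\in\mathbf 1_n^\perp$. Then $\mathcal N$ is singular at $(z,u,k)=(0,0,r_{ij}^{-1})$ and $\ker L(0)=\mathrm{span}\{\mathbf 1_n,v\}$. Furthermore, if $\frac{\partial^2K}{\partial z_C^2}$ is invertible (at $z=0$, $k=r_{ij}^{-1}$), then the Lyapunov-Schmidt reduction $f(x,u_B,k)$ of the full network equations, or equivalently that of the reduced network equations, satisfies, at $(x,u_B,k)=(0,0,r_{ij}^{-1})$, $$f=f_x=f_k=0,\quad f_{xx}=-g_-''(0)\,r_{ij}^2,\quad f_{kx}=-r_{ij}^2,\quad f_{xxx}=-g_-'''(0)\,r_{ij}^3 .$$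
   Context: Network. The network is a graph with incidence matrix $D\in\mathbb{R}^{n\times m}$, node potentials $z\in\mathbb{R}^n$ and edge voltages $y=D^\top z$, with $y_{l_-}=z_i-z_j$. The negative edge has current $I_{l_-}=-k\frac{\partial G_{l_-}}{\partial y_{l_-}}(y_{l_-})$, where $G_{l_-}$ is convex (and sufficiently smooth), $k>0$ is a tunable gain, $g_-(y)=\frac{\partial G_{l_-}}{\partial y}(y)$, with $g_-(0)=0$ and $g_-'(0)=1$. For $l\ne l_-$ the edge potential is $G_l(y_l)=\frac12R_l^{-1}y_l^2$, $R_l>0$. Thus $K(z,k)=\sum_{l\neq l_-}\frac12R_l^{-1}y_l^2-kG_{l_-}(y_{l_-})$ with $y=D^\top z$. Writing $z=(z_B,z_C)$, $u=(u_B,u_C)$ with $u_C=0$ for the boundary/central components, the network equations are $0=F(z,u,k)=\frac{\partial K}{\partial z}(z,k)-u$, and $L(z)=\frac{\partial^2K}{\partial z^2}$ is the network Laplacian. $e_{ij}\in\mathbb{R}^n$ has $1$ at position $i$, $-1$ at position $j$, zero elsewhere; $\mathbf 1_n$ is the all-ones vector. Singularity. The network is singular at $(z^*,u^*,k^* )$ if $F(z^*,u^*,k^* )=0$ and $\dim\ker L(z^* )=2$ (with $L$ evaluated at $k=k^*$). $L(0)$ in the claim is evaluated at $k=r_{ij}^{-1}$. Lyapunov-Schmidt reductions. By invariance under uniform shifts the equations are restricted to $z,u\in\mathbf 1_n^\perp$, with $F$ taking values in $\mathbf 1_n^\perp$; write $L=L(0)$ at $k=r_{ij}^{-1}$, restricted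 to $\mathbf 1_n^\perp$, with kernel spanned by $v$. Let $E$ be the orthogonal projection of $\mathbf 1_n^\perp$ onto $\operatorname{im}L$. Near $(0,0,r_{ij}^{-1})$, $W(x,u_B,k)\in\operatorname{im}L$ is the implicit function with $W(0,0,r_{ij}^{-1})=0$ and $E\,F(xv+W(x,u_B,k),(u_B,0),k)\equiv0$; then $f(x,u_B,k)=v^\top F(xv+W(x,u_B,k),(u_B,0),k)$, $x\in\mathbb{R}$. For the reduced equations, $\bar z_C(z_B,k)$ is the local solution of $\frac{\partial K}{\partial z_C}(z_B,\bar z_C,k)=0$ with $\bar z_C(0,r_{ij}^{-1})=0$, $\widehat F(z_B,u_B,k)=\frac{\partial K}{\partial z_B}(z_B,\bar z_C(z_B,k),k)-u_B$, restricted to $z_B,u_B\in\mathbf 1_{n_B}^\perp$, and the reduction is defined in the same way from $\widehat F$, with $v$ replaced by the critical vector $\hat v$ given by the orthogonal projection of the boundary component $v_B$ of $v$ onto $\mathbf 1_{n_B}^\perp$ (which spans the kernel of $\frac{\partial\widehat F}{\partial z_B}(0,0,r_{ij}^{-1})$ on $\mathbf 1_{n_B}^\perp$). Subscripts $x,k$ denote partial derivatives of $f$.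
   Formalization: The formula f_xxx = -g_-'''(0) r_ij^3 is asserted only when g_-''(0)=0; otherwise it can fail: path 1-2-3 with unit resistors, negative edge parallel to 1-2, g_-(y)=e^y-1 gives f_xxx=-7/4 for the full equations, not -1. *)

theory Defs
  imports "HOL-Analysis.Analysis"
begin

text \<open>
  Nodes and edges are the elements of the finite types \<open>'n\<close> and \<open>'m\<close>; the boundary nodes form a set
  \<open>B\<close> and the central nodes its complement. A vector of \<open>\<real>\<close>-values on a node set \<open>S\<close> is represented
  by its extension by zero, i.e. as an element of the coordinate subspace \<open>node_space S\<close>. Hence
  \<open>(z\<^sub>B, z\<^sub>C)\<close> is the sum \<open>z\<^sub>B + z\<^sub>C\<close>, and the input \<open>(u\<^sub>B, 0)\<close> is \<open>u\<^sub>B\<close> itself.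
\<close>

definition node_space :: "'n set \<Rightarrow> (real^'n) set" where
  "node_space S = {z. \<forall>a. a \<notin> S \<longrightarrow> z $ a = 0}"

definition node_part :: "'n set \<Rightarrow> real^'n \<Rightarrow> real^'n" where
  "node_part S z = (\<chi> a. if a \<in> S then z $ a else 0)"

text \<open>The orthogonal complement of the all-ones vector inside \<open>node_space S\<close>.\<close>

definition ones_perp :: "'n::finite set \<Rightarrow> (real^'n) set" where
  "ones_perp S = {z \<in> node_space S. z \<bullet> 1 = 0}"

definition orth_proj :: "(real^'n::finite) set \<Rightarrow> real^'n \<Rightarrow> real^'n" where
  "orth_proj S x = (THE p. p \<in> S \<and> (\<forall>s\<in>S. (x - p) \<bullet> s = 0))"

definition gradient :: "(real^'n::finite \<Rightarrow> real) \<Rightarrow> real^'n \<Rightarrow> real^'n" where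
  "gradient \<phi> z = (\<chi> a. frechet_derivative \<phi> (at z) (axis a 1))"

definition jacobian_matrix :: "(real^'n::finite \<Rightarrow> real^'n) \<Rightarrow> real^'n \<Rightarrow> real^'n^'n" where
  "jacobian_matrix \<Phi> z = matrix (frechet_derivative \<Phi> (at z))"

definition C_k_function :: "nat \<Rightarrow> (real \<Rightarrow> real) \<Rightarrow> bool" where
  "C_k_function k h \<longleftrightarrow>
     (\<forall>i<k. \<forall>y. (deriv ^^ i) h differentiable (at y)) \<and> continuous_on UNIV ((deriv ^^ k) h)"


definition edge_vec :: "'n::finite \<Rightarrow> 'n \<Rightarrow> real^'n" where
  "edge_vec a b = axis a 1 - axis b 1"

definition incidence_matrix :: "real^'m::finite^'n::finite \<Rightarrow> bool" where
  "incidence_matrix D \<longleftrightarrow> (\<forall>l. \<exists>a b. a \<noteq> b \<and> column l D = edge_vec a b)"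

text \<open>Connectedness of the graph that remains after deleting the edge \<open>lm\<close>.\<close>

definition connected_without :: "real^'m::finite^'n::finite \<Rightarrow> 'm \<Rightarrow> bool" where
  "connected_without D lm \<longleftrightarrow>
     (\<forall>a b. (a, b) \<in> {(c, d). \<exists>l. l \<noteq> lm \<and>
        (column l D = edge_vec c d \<or> column l D = edge_vec d c)}\<^sup>*)"

definition positive_laplacian ::
  "real^'m::finite^'n::finite \<Rightarrow> ('m \<Rightarrow> real) \<Rightarrow> 'm \<Rightarrow> real^'n^'n" where
  "positive_laplacian D R lm =
     (\<chi> a b. \<Sum>l\<in>UNIV - {lm}. D $ a $ l * inverse (R l) * D $ b $ l)"

definition potential_K ::
  "real^'m::finite^'n::finite \<Rightarrow> ('m \<Rightarrow> real) \<Rightarrow> (real \<Rightarrow> real) \<Rightarrow> 'm \<Rightarrow> real^'n \<Rightarrow> real \<Rightarrow> real" where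
  "potential_K D R G lm z k =
     (let y = transpose D *v z
      in (\<Sum>l\<in>UNIV - {lm}. 1/2 * inverse (R l) * (y $ l)\<^sup>2) - k * G (y $ lm))"

definition network_F ::
  "real^'m::finite^'n::finite \<Rightarrow> ('m \<Rightarrow> real) \<Rightarrow> (real \<Rightarrow> real) \<Rightarrow> 'm
     \<Rightarrow> real^'n \<Rightarrow> real^'n \<Rightarrow> real \<Rightarrow> real^'n" where
  "network_F D R G lm z u k = gradient (\<lambda>z. potential_K D R G lm z k) z - u"

definition network_laplacian ::
  "real^'m::finite^'n::finite \<Rightarrow> ('m \<Rightarrow> real) \<Rightarrow> (real \<Rightarrow> real) \<Rightarrow> 'm
     \<Rightarrow> real^'n \<Rightarrow> real \<Rightarrow> real^'n^'n" where
  "network_laplacian D R G lm z k =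
     jacobian_matrix (gradient (\<lambda>z. potential_K D R G lm z k)) z"

definition singular_network ::
  "real^'m::finite^'n::finite \<Rightarrow> ('m \<Rightarrow> real) \<Rightarrow> (real \<Rightarrow> real) \<Rightarrow> 'm
     \<Rightarrow> real^'n \<Rightarrow> real^'n \<Rightarrow> real \<Rightarrow> bool" where
  "singular_network D R G lm z u k \<longleftrightarrow>
     network_F D R G lm z u k = 0 \<and> dim {w. network_laplacian D R G lm z k *v w = 0} = 2"

text \<open>Invertibility of the principal block of \<open>A\<close> indexed by \<open>S\<close>, as a linear map on \<open>node_space S\<close>.\<close>

definition block_invertible :: "real^'n::finite^'n \<Rightarrow> 'n set \<Rightarrow> bool" where
  "block_invertible A S \<longleftrightarrow>
     bij_betw (\<lambda>w. node_part S (A *v w)) (node_space S) (node_space S)"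


text \<open>
  \<open>f\<close> is a Lyapunov--Schmidt reduction at \<open>(0, 0, k0)\<close> of \<open>\<Phi>(z, u, k) = 0\<close>, with \<open>z\<close> restricted to the
  subspace \<open>V\<close> and \<open>u\<close> to the subspace \<open>U\<close>, along the critical vector \<open>v\<close>. The implicit function \<open>W\<close>
  is characterised, as in the implicit function theorem, as the continuous local solution through
  the base point; \<open>f\<close> is determined only near the base point.
\<close>

definition LS_reduction ::
  "(real^'n::finite \<Rightarrow> real^'n \<Rightarrow> real \<Rightarrow> real^'n) \<Rightarrow> (real^'n) set \<Rightarrow> (real^'n) set
     \<Rightarrow> real \<Rightarrow> real^'n \<Rightarrow> (real \<Rightarrow> real^'n \<Rightarrow> real \<Rightarrow> real) \<Rightarrow> bool" where
  "LS_reduction \<Phi> V U k0 v f \<longleftrightarrow>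
     (let I = (\<lambda>z. jacobian_matrix (\<lambda>z. \<Phi> z 0 k0) 0 *v z) ` V in
      \<exists>W S. open S \<and> (0, 0, k0) \<in> S \<and> W 0 0 k0 = 0 \<and>
        continuous_on {(x, u, k). (x, u, k) \<in> S \<and> u \<in> U} (\<lambda>(x, u, k). W x u k) \<and>
        (\<forall>x u k. (x, u, k) \<in> S \<and> u \<in> U \<longrightarrow>
           W x u k \<in> I \<and>
           orth_proj I (\<Phi> (x *\<^sub>R v + W x u k) u k) = 0 \<and>
           f x u k = v \<bullet> \<Phi> (x *\<^sub>R v + W x u k) u k))"

definition full_LS_reduction ::
  "real^'m::finite^'n::finite \<Rightarrow> ('m \<Rightarrow> real) \<Rightarrow> (real \<Rightarrow> real) \<Rightarrow> 'm \<Rightarrow> 'n set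
     \<Rightarrow> real \<Rightarrow> real^'n \<Rightarrow> (real \<Rightarrow> real^'n \<Rightarrow> real \<Rightarrow> real) \<Rightarrow> bool" where
  "full_LS_reduction D R G lm B k0 v f \<longleftrightarrow>
     LS_reduction (network_F D R G lm) (ones_perp UNIV) (ones_perp B) k0 v f"

definition central_solution ::
  "real^'m::finite^'n::finite \<Rightarrow> ('m \<Rightarrow> real) \<Rightarrow> (real \<Rightarrow> real) \<Rightarrow> 'm \<Rightarrow> 'n set
     \<Rightarrow> real \<Rightarrow> (real^'n \<Rightarrow> real \<Rightarrow> real^'n) \<Rightarrow> bool" where
  "central_solution D R G lm B k0 zC \<longleftrightarrow>
     (\<exists>S. open S \<and> (0, k0) \<in> S \<and> zC 0 k0 = 0 \<and>
        continuous_on {(zB, k). (zB, k) \<in> S \<and> zB \<in> node_space B} (\<lambda>(zB, k). zC zB k) \<and>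
        (\<forall>zB k. (zB, k) \<in> S \<and> zB \<in> node_space B \<longrightarrow>
           zC zB k \<in> node_space (- B) \<and>
           node_part (- B) (gradient (\<lambda>z. potential_K D R G lm z k) (zB + zC zB k)) = 0))"

text \<open>
  Only arguments \<open>z\<close> in \<open>node_space B\<close> matter; precomposing with \<open>node_part B\<close> extends the reduced
  vector field to all of \<open>real^'n\<close>, so that its Jacobian makes sense.
\<close>

definition reduced_F ::
  "real^'m::finite^'n::finite \<Rightarrow> ('m \<Rightarrow> real) \<Rightarrow> (real \<Rightarrow> real) \<Rightarrow> 'm \<Rightarrow> 'n set
     \<Rightarrow> (real^'n \<Rightarrow> real \<Rightarrow> real^'n) \<Rightarrow> real^'n \<Rightarrow> real^'n \<Rightarrow> real \<Rightarrow> real^'n" where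
  "reduced_F D R G lm B zC z u k =
     (let zB = node_part B z
      in node_part B (gradient (\<lambda>z. potential_K D R G lm z k) (zB + zC zB k)) - u)"

definition reduced_LS_reduction ::
  "real^'m::finite^'n::finite \<Rightarrow> ('m \<Rightarrow> real) \<Rightarrow> (real \<Rightarrow> real) \<Rightarrow> 'm \<Rightarrow> 'n set
     \<Rightarrow> real \<Rightarrow> real^'n \<Rightarrow> (real \<Rightarrow> real^'n \<Rightarrow> real \<Rightarrow> real) \<Rightarrow> bool" where
  "reduced_LS_reduction D R G lm B k0 v f \<longleftrightarrow>
     (\<exists>zC. central_solution D R G lm B k0 zC \<and>
        LS_reduction (reduced_F D R G lm B zC) (ones_perp B) (ones_perp B) k0
          (orth_proj (ones_perp B) (node_part B v)) f)"

end

theory Submission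
  imports Defs
begin

text \<open>
  Write \<open>M\<close> for the positive Laplacian and \<open>e\<close> for the edge vector, so that
  \<open>F(z, u, k) = M z - k g(e \<bullet> z) e - u\<close> is nonlinear only through the scalar \<open>s = e \<bullet> z\<close>. Eliminating
  the central nodes by a Schur complement keeps this form: \<open>M\<close> becomes a positive definite operator
  \<open>A\<close>, \<open>e\<close> becomes \<open>a = A v\<close>, and \<open>s\<close> is now the solution of \<open>s - k \<beta> g(s) = a \<bullet> z\<close>, where
  \<open>a \<bullet> v = r - \<beta>\<close>. Both reductions are therefore instances of one rank-one problem.

  For that problem the projected equation says \<open>A z - k g(s) a - u = \<mu> v\<close> with \<open>f = \<mu> (v \<bullet> v)\<close>. Pairing
  it with \<open>v\<close> gives \<open>f = s - k r g(s) - v \<bullet> u\<close>. Pairing it with \<open>p = A\<inverse> v\<close> gives, at \<open>u = 0\<close>,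
  \<open>f = c (x - k g(s))\<close> with \<open>c = (v \<bullet> v)\<^sup>2 / (v \<bullet> p) > 0\<close>. Hence \<open>s\<close> is the scalar implicit function of
  \<open>s - k (r - c) g(s) = c x\<close>, independently of \<open>\<beta>\<close>, and the derivatives of \<open>f\<close> follow by the
  chain rule from \<open>s\<^sub>x = r\<close> at the base point.
\<close>

subsection \<open>The scalar equation\<close>

text \<open>The inverse function theorem is applied to
  \<open>(s, k) \<mapsto> (s - k * \<gamma> * g s, k)\<close>; carrying \<open>k\<close> as a
  coordinate makes the solution jointly continuous. The set \<open>N\<close> is kept in the
  conclusion because it provides uniqueness: a solution known to stay in \<open>N\<close> must
  coincide with \<open>\<sigma>\<close>.\<close>

lemma implicit_scalar:
  fixes g :: "real \<Rightarrow> real" and k0 \<gamma> :: real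
  assumes dg: "\<And>y. (g has_real_derivative deriv g y) (at y)"
    and cg: "continuous_on UNIV (deriv g)"
    and g0: "g 0 = 0" and g1: "deriv g 0 = 1" and nz: "1 - k0 * \<gamma> \<noteq> 0"
  obtains \<sigma> T N where
    "open T" "(0, k0) \<in> T" "open N" "(0, k0) \<in> N" "continuous_on T (\<lambda>(t, k). \<sigma> t k)"
    "\<And>t k. (t, k) \<in> T \<Longrightarrow> (\<sigma> t k, k) \<in> N \<and> \<sigma> t k - k * \<gamma> * g (\<sigma> t k) = t"
    "\<And>s k. (s, k) \<in> N \<Longrightarrow> (s - k * \<gamma> * g s, k) \<in> T \<and> \<sigma> (s - k * \<gamma> * g s) k = s"
    "\<And>s k. (s, k) \<in> N \<Longrightarrow> 1 - k * \<gamma> * deriv g s \<noteq> 0"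
    "\<And>t k. (t, k) \<in> T \<Longrightarrow>
       ((\<lambda>t. \<sigma> t k) has_real_derivative inverse (1 - k * \<gamma> * deriv g (\<sigma> t k))) (at t)"
proof -
  define f where "f = (\<lambda>(s, k). (s - k * \<gamma> * g s, k :: real))"
  define U where "U = {p. 1 - snd p * \<gamma> * deriv g (fst p) \<noteq> 0}"
  define L where "L = (\<lambda>p::real \<times> real. \<lambda>d::real \<times> real.
     ((1 - snd p * \<gamma> * deriv g (fst p)) * fst d - \<gamma> * g (fst p) * snd d, snd d))"
  have gd: "\<And>h h' x S. (h has_derivative h') (at x within S) \<Longrightarrow>
      ((\<lambda>x. g (h x)) has_derivative (\<lambda>d. h' d * deriv g (h x))) (at x within S)"
    using DERIV_compose_FDERIV[OF dg] .
  have contg: "continuous_on S g" for S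
    by (meson DERIV_isCont continuous_at_imp_continuous_on dg)
  have blL: "bounded_linear (L p)" for p
    unfolding L_def by (intro bounded_linear_intros)
  have opU: "open U"
    unfolding U_def by (intro open_Collect_neq continuous_intros continuous_on_compose2[OF cg]) auto
  have U0: "(0, k0) \<in> U" using nz g1 by (simp add: U_def)
  have derf: "(f has_derivative blinfun_apply (Blinfun (L p))) (at p)" for p
  proof -
    have "(f has_derivative L p) (at p)"
      unfolding f_def case_prod_unfold L_def
      by (auto intro!: derivative_eq_intros gd simp: fun_eq_iff algebra_simps)
    then show ?thesis by (simp add: bounded_linear_Blinfun_apply[OF blL])
  qed
  have contL: "continuous_on U (\<lambda>p. Blinfun (L p))"
    unfolding L_def
    by (rule continuous_on_blinfun_componentwise, subst bounded_linear_Blinfun_apply[OF blL[unfolded L_def]],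
       intro continuous_intros continuous_on_compose2[OF cg] continuous_on_compose2[OF contg[of UNIV]]) auto
  \<comment> \<open>The off-diagonal entry of the derivative at \<open>(0, k0)\<close> is
    \<open>- \<gamma> * g 0 = 0\<close>, so its inverse is diagonal.\<close>
  define invf where "invf = Blinfun (\<lambda>d::real \<times> real. (inverse (1 - k0 * \<gamma>) * fst d, snd d))"
  have bi: "bounded_linear (\<lambda>d::real \<times> real. (inverse (1 - k0 * \<gamma>) * fst d, snd d))"
    by (intro bounded_linear_intros)
  have inv: "invf o\<^sub>L Blinfun (L (0, k0)) = id_blinfun"
    by (rule blinfun_eqI)
      (use nz in \<open>simp add: invf_def bounded_linear_Blinfun_apply[OF bi] bounded_linear_Blinfun_apply[OF blL],
        simp add: L_def g0 g1 prod_eq_iff flip: mult.assoc\<close>)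
  obtain N T h h' where N: "open N" "N \<subseteq> U" "(0, k0) \<in> N" and T: "open T" "f (0, k0) \<in> T"
    and hom: "homeomorphism N T f h"
    using inverse_function_theorem[OF opU derf contL U0 inv] by metis
  define \<sigma> where "\<sigma> = (\<lambda>t k. fst (h (t, k)))"
  have hT: "h (t, k) = (\<sigma> t k, k)" "h (t, k) \<in> N" "\<sigma> t k - k * \<gamma> * g (\<sigma> t k) = t" if "(t, k) \<in> T" for t k
    using hom that unfolding homeomorphism_def f_def \<sigma>_def
    by (auto simp: case_prod_unfold prod_eq_iff dest!: bspec)
  have hN: "(s - k * \<gamma> * g s, k) \<in> T \<and> \<sigma> (s - k * \<gamma> * g s) k = s" if "(s, k) \<in> N" for s k
  proof -
    have "f (s, k) \<in> T" "h (f (s, k)) = (s, k)"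
      using hom that unfolding homeomorphism_def by auto
    then show ?thesis by (simp add: f_def \<sigma>_def)
  qed
  have nzN: "1 - k * \<gamma> * deriv g s \<noteq> 0" if "(s, k) \<in> N" for s k
    using that N(2) by (auto simp: U_def)
  have cont\<sigma>: "continuous_on T (\<lambda>(t, k). \<sigma> t k)"
    using hom unfolding homeomorphism_def \<sigma>_def case_prod_unfold
    by (auto intro: continuous_intros)
  have der: "((\<lambda>t. \<sigma> t k) has_real_derivative inverse (1 - k * \<gamma> * deriv g (\<sigma> t k))) (at t)"
    if tk: "(t, k) \<in> T" for t k
  proof -
    let ?m = "1 - k * \<gamma> * deriv g (\<sigma> t k)"
    have m: "?m \<noteq> 0" using nzN hT tk by metis
    have op: "open ((\<lambda>t. (t, k)) -` T)"
      by (intro open_vimage T continuous_intros)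
    have "isCont (\<lambda>p. case p of (t, k) \<Rightarrow> \<sigma> t k) (t, k)"
      using cont\<sigma> T(1) tk continuous_on_eq_continuous_at by blast
    then have c: "isCont (\<lambda>t. \<sigma> t k) t"
      using isCont_o2[of t "\<lambda>t. (t, k)" "\<lambda>p. case p of (t, k) \<Rightarrow> \<sigma> t k"] by auto
    have "((\<lambda>s. s - k * \<gamma> * g s) has_derivative (*) ?m) (at (\<sigma> t k))"
      by (auto intro!: derivative_eq_intros gd simp: fun_eq_iff algebra_simps)
    \<comment> \<open>A continuous inverse branch is differentiable wherever the direct map has an
      invertible derivative.\<close>
    then have "((\<lambda>t. \<sigma> t k) has_derivative (*) (inverse ?m)) (at t)"
      by (rule has_derivative_inverse_basic[where T = "(\<lambda>t. (t, k)) -` T"])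
        (use m c op tk hT in \<open>auto simp: fun_eq_iff intro!: bounded_linear_mult_right\<close>)
    then show ?thesis by (simp add: has_field_derivative_def)
  qed
  have "(0, k0) \<in> T" using T(2) by (simp add: f_def g0)
  then show ?thesis
    using that[of T N \<sigma>] N T(1) cont\<sigma> hT hN nzN der by metis
qed

text \<open>The third derivative is guarded by \<open>g''(0) = 0\<close>: in general it acquires the
  extra term \<open>- 3 g''(0)^2 r^3 (r - c) / c\<close>, where \<open>c\<close> is the constant of
  the scalar equation below and need not agree for the full and the reduced equations.\<close>

definition reduction_derivatives :: "(real \<Rightarrow> real) \<Rightarrow> real \<Rightarrow> (real \<Rightarrow> real \<Rightarrow> real) \<Rightarrow> bool" where
  "reduction_derivatives g r f \<longleftrightarrow>
     f 0 (inverse r) = 0 \<and>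
     ((\<lambda>x. f x (inverse r)) has_real_derivative 0) (at 0) \<and>
     ((\<lambda>k. f 0 k) has_real_derivative 0) (at (inverse r)) \<and>
     (deriv (\<lambda>x. f x (inverse r)) has_real_derivative - (deriv ^^ 2) g 0 * r\<^sup>2) (at 0) \<and>
     ((\<lambda>k. deriv (\<lambda>x. f x k) 0) has_real_derivative - r\<^sup>2) (at (inverse r)) \<and>
     ((deriv ^^ 2) g 0 = 0 \<longrightarrow>
       ((deriv ^^ 2) (\<lambda>x. f x (inverse r)) has_real_derivative - (deriv ^^ 3) g 0 * r ^ 3) (at 0))"

text \<open>Nothing beyond continuity is known about \<open>s\<close>. Uniqueness identifies it near
  the base point with the differentiable branch \<open>\<sigma> (c * x) k\<close>, and then the
  chain rule applies.\<close>

lemma reduced_scalar_derivatives: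
  fixes g :: "real \<Rightarrow> real" and s f :: "real \<Rightarrow> real \<Rightarrow> real"
  assumes dg: "\<And>y. (g has_real_derivative deriv g y) (at y)"
    and dg1: "\<And>y. (deriv g has_real_derivative (deriv ^^ 2) g y) (at y)"
    and dg2: "\<And>y. ((deriv ^^ 2) g has_real_derivative (deriv ^^ 3) g y) (at y)"
    and g0: "g 0 = 0" and g1: "deriv g 0 = 1" and r: "r \<noteq> 0" and c: "c \<noteq> 0"
    and \<Omega>: "open \<Omega>" "(0, inverse r) \<in> \<Omega>"
    and conts: "continuous_on \<Omega> (\<lambda>(x, k). s x k)" and s0: "s 0 (inverse r) = 0"
    and eq: "\<And>x k. (x, k) \<in> \<Omega> \<Longrightarrow> s x k - k * (r - c) * g (s x k) = c * x"
    and f: "\<And>x k. (x, k) \<in> \<Omega> \<Longrightarrow> f x k = s x k - k * r * g (s x k)"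
  shows "reduction_derivatives g r f"
proof -
  define k0 where "k0 = inverse r"
  define \<gamma> where "\<gamma> = r - c"
  define m where "m = (\<lambda>k s. 1 - k * \<gamma> * deriv g s)"
  have cg: "continuous_on UNIV (deriv g)"
    by (meson DERIV_isCont continuous_at_imp_continuous_on dg1)
  \<comment> \<open>Since \<open>s\<close> has \<open>x\<close>-derivative \<open>c / m\<close>,
    this value makes it \<open>r\<close> at the base point; this is how \<open>c\<close> cancels
    from the results.\<close>
  have m0: "m k0 0 = c / r" using r by (simp add: m_def k0_def \<gamma>_def g1 field_simps)
  have nz: "1 - k0 * \<gamma> \<noteq> 0" using m0 c r by (simp add: m_def g1)
  obtain \<sigma> T N where T: "open T" "(0, k0) \<in> T" and N: "open N" "(0, k0) \<in> N"
    and "continuous_on T (\<lambda>(t, k). \<sigma> t k)"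
    and \<sigma>T: "\<And>t k. (t, k) \<in> T \<Longrightarrow> (\<sigma> t k, k) \<in> N \<and> \<sigma> t k - k * \<gamma> * g (\<sigma> t k) = t"
    and \<sigma>N: "\<And>s k. (s, k) \<in> N \<Longrightarrow> (s - k * \<gamma> * g s, k) \<in> T \<and> \<sigma> (s - k * \<gamma> * g s) k = s"
    and mN: "\<And>s k. (s, k) \<in> N \<Longrightarrow> m k s \<noteq> 0"
    and d\<sigma>: "\<And>t k. (t, k) \<in> T \<Longrightarrow> ((\<lambda>t. \<sigma> t k) has_real_derivative inverse (m k (\<sigma> t k))) (at t)"
    by (rule implicit_scalar[OF dg cg g0 g1 nz]) (rule that[unfolded m_def])
  \<comment> \<open>Both \<open>s x k\<close> and \<open>0\<close> are required to lie in the
    uniqueness set: the first identifies \<open>s\<close> with the branch, the second forces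
    \<open>s 0 k = 0\<close> for every nearby \<open>k\<close>.\<close>
  define \<Omega>' where "\<Omega>' = (\<Omega> \<inter> (\<lambda>(x, k). (s x k, k)) -` N) \<inter> (\<lambda>(x, k). (0, k)) -` N"
  have "open (\<Omega> \<inter> (\<lambda>(x, k). (s x k, k)) -` N)"
    using conts N(1) \<Omega>(1)
    by (intro continuous_open_preimage) (auto simp: case_prod_unfold intro!: continuous_intros)
  moreover have "open ((\<lambda>(x, k). (0 :: real, k :: real)) -` N :: (real \<times> real) set)"
    unfolding case_prod_unfold by (intro open_vimage N continuous_intros)
  ultimately have op: "open \<Omega>'" unfolding \<Omega>'_def by blast
  have in0: "(0, k0) \<in> \<Omega>'" using \<Omega>(2) N(2) s0 by (simp add: \<Omega>'_def k0_def)
  have s\<sigma>: "s x k = \<sigma> (c * x) k" and cxT: "(c * x, k) \<in> T" if "(x, k) \<in> \<Omega>'" for x k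
    using that eq[of x k] \<sigma>N[of "s x k" k] by (auto simp: \<Omega>'_def \<gamma>_def)
  have s0k: "s 0 k = 0" if "(0, k) \<in> \<Omega>'" for k
    using that s\<sigma>[OF that] \<sigma>N[of 0 k] by (auto simp: \<Omega>'_def g0)
  have m_nz: "m k (s x k) \<noteq> 0" if "(x, k) \<in> \<Omega>'" for x k
    using that mN by (auto simp: \<Omega>'_def)
  have opx: "open {x. (x, k) \<in> \<Omega>'}" for k
    using open_vimage[OF op, of "\<lambda>x. (x, k)"] by (simp add: vimage_def continuous_intros)
  have opk: "open {k. (x, k) \<in> \<Omega>'}" for x
    using open_vimage[OF op, of "\<lambda>k. (x, k)"] by (simp add: vimage_def continuous_intros)
  have ds: "((\<lambda>x. s x k) has_real_derivative c / m k (s x k)) (at x)" if "(x, k) \<in> \<Omega>'" for x k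
  proof -
    have "((\<lambda>x. \<sigma> (c * x) k) has_real_derivative inverse (m k (\<sigma> (c * x) k)) * (c * 1)) (at x)"
      by (rule DERIV_chain2[where g = "\<lambda>x. c * x", OF d\<sigma>[OF cxT[OF that]]]) (auto intro!: derivative_eq_intros)
    then have "((\<lambda>x. \<sigma> (c * x) k) has_real_derivative c / m k (s x k)) (at x)"
      using s\<sigma>[OF that] by (simp add: field_simps)
    then show ?thesis
      by (rule has_field_derivative_transform_within_open[OF _ opx[of k]]) (use that s\<sigma> in auto)
  qed
  have df: "((\<lambda>x. f x k) has_real_derivative (1 - k * r * deriv g (s x k)) * (c / m k (s x k))) (at x)"
    if "(x, k) \<in> \<Omega>'" for x k
  proof -
    have "((\<lambda>x. s x k - k * r * g (s x k)) has_real_derivative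
        (1 - k * r * deriv g (s x k)) * (c / m k (s x k))) (at x)"
      using DERIV_chain2[where f = g, OF dg ds[OF that]] ds[OF that]
      by (auto intro!: derivative_eq_intros simp: algebra_simps)
    then show ?thesis
      by (rule has_field_derivative_transform_within_open[OF _ opx[of k]])
        (use that in \<open>simp_all add: \<Omega>'_def f\<close>)
  qed
  define X where "X = {x. (x, k0) \<in> \<Omega>'}"
  have X: "open X" "0 \<in> X" using opx in0 by (auto simp: X_def)
  have s00: "s 0 k0 = 0" using s0 by (simp add: k0_def)
  have kr: "k0 * r = 1" using r by (simp add: k0_def)
  have c1: "f 0 (inverse r) = 0" using f \<Omega>(2) s0 g0 by simp
  have c2: "((\<lambda>x. f x (inverse r)) has_real_derivative 0) (at 0)"
    using df[OF in0] kr s00 g1 by (simp add: k0_def)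
  have c3: "((\<lambda>k. f 0 k) has_real_derivative 0) (at (inverse r))"
  proof (rule has_field_derivative_transform_within_open[OF _ opk[of 0]])
    show "((\<lambda>k. 0) has_real_derivative 0) (at (inverse r))" by simp
    show "0 = f 0 k" if "k \<in> {k. (0, k) \<in> \<Omega>'}" for k
    proof -
      have "(0, k) \<in> \<Omega>" using that by (simp add: \<Omega>'_def)
      from f[OF this] show ?thesis using s0k[of k] that g0 by simp
    qed
  qed (use in0 in \<open>simp add: k0_def\<close>)
  \<comment> \<open>At \<open>k = k0\<close> one has \<open>k0 * r = 1\<close>, so
    \<open>\<phi>\<close> is the first \<open>x\<close>-derivative of \<open>f\<close> written as a
    function of \<open>s\<close>. Then \<open>\<psi>\<close> is the second one:
    \<open>\<phi>'\<close> times the inner derivative \<open>c / m\<close>.\<close>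
  define \<phi> where "\<phi> = (\<lambda>s. (1 - deriv g s) * (c / m k0 s))"
  define \<psi> where "\<psi> = (\<lambda>s. (- (deriv ^^ 2) g s * m k0 s + (1 - deriv g s) * (k0 * \<gamma> * (deriv ^^ 2) g s))
      * c ^ 2 / m k0 s ^ 3)"
  have f1: "deriv (\<lambda>x. f x k0) x = \<phi> (s x k0)" if "x \<in> X" for x
    using DERIV_imp_deriv[OF df[of x k0]] that kr by (simp add: \<phi>_def X_def)
  have d\<phi>: "((\<lambda>x. \<phi> (s x k0)) has_real_derivative \<psi> (s x k0)) (at x)" if "x \<in> X" for x
  proof -
    have xk: "(x, k0) \<in> \<Omega>'" using that by (simp add: X_def)
    note mnz = m_nz[OF xk]
    have dm: "(m k0 has_real_derivative - (k0 * \<gamma> * (deriv ^^ 2) g y)) (at y)" for y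
      unfolding m_def by (auto intro!: derivative_eq_intros dg1)
    have "(\<phi> has_real_derivative \<psi> (s x k0) / (c / m k0 (s x k0))) (at (s x k0))"
      unfolding \<phi>_def \<psi>_def
      using mnz c
      by (auto intro!: derivative_eq_intros dg1 dm simp: field_simps power2_eq_square power3_eq_cube)
    from DERIV_chain2[OF this ds[OF xk]] show ?thesis
      using mnz c by simp
  qed
  have f2: "(deriv (\<lambda>x. f x k0) has_real_derivative \<psi> (s x k0)) (at x)" if "x \<in> X" for x
    by (rule has_field_derivative_transform_within_open[OF d\<phi>[OF that] X(1) that]) (simp add: f1)
  have c4: "(deriv (\<lambda>x. f x (inverse r)) has_real_derivative - (deriv ^^ 2) g 0 * r\<^sup>2) (at 0)"
    using f2[OF X(2)] c r unfolding s00 \<psi>_def m0 g1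
    by (simp add: k0_def field_simps power2_eq_square power3_eq_cube)
  have c5: "((\<lambda>k. deriv (\<lambda>x. f x k) 0) has_real_derivative - r\<^sup>2) (at (inverse r))"
  proof (rule has_field_derivative_transform_within_open[OF _ opk[of 0]])
    have nz': "1 - inverse r * \<gamma> \<noteq> 0" "1 - inverse r * \<gamma> = c / r"
      using nz m0 g1 by (auto simp: k0_def m_def)
    \<comment> \<open>Along \<open>x = 0\<close> the branch vanishes, so the first
      \<open>x\<close>-derivative is this explicit rational function of \<open>k\<close>. Its factor
      \<open>1 - k * r\<close> is zero at the base point, so only the derivative of that factor
      contributes.\<close>
    have "((\<lambda>k. (1 - k * r) * (c / (1 - k * \<gamma>))) has_real_derivative - r * (c / (1 - inverse r * \<gamma>)))
      (at (inverse r))"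
      using nz'(1) r by (auto intro!: derivative_eq_intros)
    then show "((\<lambda>k. (1 - k * r) * (c / (1 - k * \<gamma>))) has_real_derivative - r\<^sup>2) (at (inverse r))"
      using c r unfolding nz'(2) by (simp add: power2_eq_square)
    show "(1 - k * r) * (c / (1 - k * \<gamma>)) = deriv (\<lambda>x. f x k) 0" if "k \<in> {k. (0, k) \<in> \<Omega>'}" for k
      using DERIV_imp_deriv[OF df[of 0 k]] s0k[of k] that g1 by (simp add: m_def)
  qed (use in0 in \<open>simp add: k0_def\<close>)
  have c6: "((deriv ^^ 2) (\<lambda>x. f x (inverse r)) has_real_derivative - (deriv ^^ 3) g 0 * r ^ 3) (at 0)"
    if g2: "(deriv ^^ 2) g 0 = 0"
  proof -
    have dm: "(m k0 has_real_derivative - (k0 * \<gamma> * (deriv ^^ 2) g y)) (at y)" for y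
      unfolding m_def by (auto intro!: derivative_eq_intros dg1)
    \<comment> \<open>With \<open>g''(0) = 0\<close> and \<open>g'(0) = 1\<close> the only surviving
      contribution comes from differentiating the leading \<open>g''\<close>; the product
      \<open>(1 - g') g''\<close> vanishes to second order.\<close>
    have "(\<psi> has_real_derivative - (deriv ^^ 3) g 0 * c ^ 2 / (c / r) ^ 2) (at 0)"
      unfolding \<psi>_def using c r
      by (auto intro!: derivative_eq_intros dg1 dg2 dm simp: m0 g1 g2 power2_eq_square power3_eq_cube field_simps)
    then have "(\<psi> has_real_derivative - (deriv ^^ 3) g 0 * r ^ 2) (at (s 0 k0))"
      using c r by (simp add: s00 power2_eq_square)
    from DERIV_chain2[OF this ds[OF in0]]
    have "((\<lambda>x. \<psi> (s x k0)) has_real_derivative - (deriv ^^ 3) g 0 * r ^ 3) (at 0)"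
      using c r by (simp add: s00 m0 power2_eq_square power3_eq_cube mult.assoc)
    then have "((deriv ^^ 2) (\<lambda>x. f x k0) has_real_derivative - (deriv ^^ 3) g 0 * r ^ 3) (at 0)"
      by (rule has_field_derivative_transform_within_open[OF _ X])
        (simp add: numeral_2_eq_2 DERIV_imp_deriv[OF f2])
    then show ?thesis by (simp add: k0_def)
  qed
  show ?thesis unfolding reduction_derivatives_def using c1 c2 c3 c4 c5 c6 by blast
qed

subsection \<open>Reductions with a rank-one nonlinearity\<close>

lemma orth_proj_characterisation:
  fixes S :: "(real^'n::finite) set"
  assumes "subspace S"
  shows "orth_proj S x \<in> S" and "\<And>s. s \<in> S \<Longrightarrow> (x - orth_proj S x) \<bullet> s = 0"
    and "orth_proj S x = 0 \<longleftrightarrow> (\<forall>s\<in>S. x \<bullet> s = 0)"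
proof -
  have spS: "span S = S" using assms by (simp add: span_eq_iff)
  obtain y z where y: "y \<in> S" and z: "\<And>w. w \<in> S \<Longrightarrow> orthogonal z w" and x: "x = y + z"
    using orthogonal_subspace_decomp_exists[of S x] spS by metis
  have ex: "y \<in> S \<and> (\<forall>s\<in>S. (x - y) \<bullet> s = 0)" using y z x by (simp add: orthogonal_def)
  have uniq: "p = y" if p: "p \<in> S \<and> (\<forall>s\<in>S. (x - p) \<bullet> s = 0)" for p
  proof -
    have "p - y \<in> S" using p y assms by (simp add: subspace_diff)
    then have "(x - y) \<bullet> (p - y) = 0" "(x - p) \<bullet> (p - y) = 0" using p ex by auto
    then have "(p - y) \<bullet> (p - y) = 0" by (simp add: inner_diff_left)
    then show ?thesis by simp
  qed
  have oy: "orth_proj S x = y"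
    unfolding orth_proj_def by (rule the_equality) (fact ex, fact uniq)
  show "orth_proj S x \<in> S" "\<And>s. s \<in> S \<Longrightarrow> (x - orth_proj S x) \<bullet> s = 0" using oy ex by auto
  show "orth_proj S x = 0 \<longleftrightarrow> (\<forall>s\<in>S. x \<bullet> s = 0)"
    using oy ex uniq[of 0] subspace_0[OF assms] by auto
qed

lemma orth_proj_eqI:
  fixes S :: "(real^'n::finite) set"
  assumes S: "subspace S" and p: "p \<in> S" and orth: "\<And>s. s \<in> S \<Longrightarrow> (x - p) \<bullet> s = 0"
  shows "orth_proj S x = p"
proof -
  let ?d = "orth_proj S x - p"
  have "?d \<in> S" using orth_proj_characterisation(1)[OF S] p S by (simp add: subspace_diff)
  then have "(x - orth_proj S x) \<bullet> ?d = 0" "(x - p) \<bullet> ?d = 0"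
    using orth_proj_characterisation(2)[OF S] orth by auto
  then have "?d \<bullet> ?d = 0" by (simp add: inner_diff_left)
  then show ?thesis by simp
qed

text \<open>An injective endomorphism of a finite-dimensional space is onto, so a left inverse is
  two-sided on \<open>V\<close>. Choosing \<open>P\<close> linear on the whole space with values in
  \<open>V\<close> makes its continuity immediate.\<close>

lemma linear_inverse_on_subspace:
  fixes A :: "'a::euclidean_space \<Rightarrow> 'a"
  assumes V: "subspace V" and A: "linear A" and AV: "\<And>z. z \<in> V \<Longrightarrow> A z \<in> V"
    and ker: "\<And>z. z \<in> V \<Longrightarrow> A z = 0 \<Longrightarrow> z = 0"
  obtains P where "linear P" "\<And>w. P w \<in> V" "\<And>z. z \<in> V \<Longrightarrow> P (A z) = z" "\<And>w. w \<in> V \<Longrightarrow> A (P w) = w"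
proof -
  have inj: "inj_on A V" using linear_injective_on_subspace_0[OF A V] ker by blast
  obtain P where P: "range P \<subseteq> V" "linear P" "\<And>z. z \<in> V \<Longrightarrow> P (A z) = z"
    using linear_exists_left_inverse_on[OF A V inj] by (auto simp: linear_def)
  have "A ` V = V"
    by (rule subspace_dim_equal)
      (use V A AV inj in \<open>auto simp: linear_subspace_image dim_image_eq span_eq_iff[THEN iffD2]\<close>)
  then show ?thesis
    using that[of P] P by (metis imageE rangeI subsetD)
qed

text \<open>The full equations are the case \<open>\<beta> = 0\<close>, where \<open>s\<close> is
  linear; in the reduced equations \<open>s\<close> is only implicitly given. The condition
  \<open>r \<noteq> \<beta>\<close> makes \<open>s - k * \<beta> * g s\<close> locally invertible in
  \<open>s\<close>. The denominator in the Jacobian is \<open>r - \<beta>\<close> because the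
  gradient of \<open>s\<close> at the base point is \<open>a / (1 - \<beta> / r)\<close>, multiplied
  by \<open>k = 1 / r\<close>.\<close>

locale rank_one_reduction =
  fixes V U :: "(real^'n::finite) set" and A :: "real^'n \<Rightarrow> real^'n" and a v :: "real^'n"
    and g :: "real \<Rightarrow> real" and r \<beta> :: real
    and \<Phi> :: "real^'n \<Rightarrow> real^'n \<Rightarrow> real \<Rightarrow> real^'n" and s :: "real^'n \<Rightarrow> real \<Rightarrow> real"
    and \<Omega> :: "((real^'n) \<times> real) set"
  assumes V: "subspace V" and U: "U \<subseteq> V" "0 \<in> U"
    and A: "linear A" and AV: "\<And>z. z \<in> V \<Longrightarrow> A z \<in> V"
    and sym: "\<And>y z. y \<in> V \<Longrightarrow> z \<in> V \<Longrightarrow> A y \<bullet> z = y \<bullet> A z"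
    and pos: "\<And>z. z \<in> V \<Longrightarrow> z \<noteq> 0 \<Longrightarrow> A z \<bullet> z > 0"
    and vV: "v \<in> V" and Av: "A v = a" and av: "a \<bullet> v = r - \<beta>"
    and r: "r \<noteq> 0" and r\<beta>: "r \<noteq> \<beta>"
    and dg: "\<And>y. (g has_real_derivative deriv g y) (at y)"
    and dg1: "\<And>y. (deriv g has_real_derivative (deriv ^^ 2) g y) (at y)"
    and dg2: "\<And>y. ((deriv ^^ 2) g has_real_derivative (deriv ^^ 3) g y) (at y)"
    and g0: "g 0 = 0" and g1: "deriv g 0 = 1"
    and \<Omega>: "open \<Omega>" "(0, inverse r) \<in> \<Omega>"
    and conts: "continuous_on {(z, k). (z, k) \<in> \<Omega> \<and> z \<in> V} (\<lambda>(z, k). s z k)"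
    and s0: "s 0 (inverse r) = 0"
    and s_eq: "\<And>z k. (z, k) \<in> \<Omega> \<Longrightarrow> z \<in> V \<Longrightarrow> s z k - k * \<beta> * g (s z k) = a \<bullet> z"
    and \<Phi>: "\<And>z u k. (z, k) \<in> \<Omega> \<Longrightarrow> z \<in> V \<Longrightarrow> u \<in> U \<Longrightarrow> \<Phi> z u k = A z - (k * g (s z k)) *\<^sub>R a - u"
    and jacobian: "\<And>z. z \<in> V \<Longrightarrow>
      jacobian_matrix (\<lambda>z. \<Phi> z 0 (inverse r)) 0 *v z = A z - ((a \<bullet> z) / (r - \<beta>)) *\<^sub>R a"
begin

lemma A_ker: "z \<in> V \<Longrightarrow> A z = 0 \<Longrightarrow> z = 0"
  using pos[of z] by (cases "z = 0") auto

definition P where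
  "P = (SOME P. linear P \<and> (\<forall>w. P w \<in> V) \<and> (\<forall>z\<in>V. P (A z) = z) \<and> (\<forall>w\<in>V. A (P w) = w))"

lemma P: "linear P" "P w \<in> V" "w \<in> V \<Longrightarrow> A (P w) = w"
proof -
  have "\<exists>P. linear P \<and> (\<forall>w. P w \<in> V) \<and> (\<forall>z\<in>V. P (A z) = z) \<and> (\<forall>w\<in>V. A (P w) = w)"
    using linear_inverse_on_subspace[OF V A AV A_ker] by metis
  from someI_ex[OF this] show "linear P" "P w \<in> V" "w \<in> V \<Longrightarrow> A (P w) = w"
    unfolding P_def by blast+
qed

definition p where "p = P v"

lemma p: "p \<in> V" "A p = v"
  using P vV by (auto simp: p_def)

lemma aV: "a \<in> V" using Av AV vV by metis

lemma v_nz: "v \<noteq> 0"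
  using av r\<beta> by auto

lemma vp: "v \<bullet> p > 0"
  using pos[of p] p v_nz A by (metis linear_0)

definition c where "c = (v \<bullet> v)\<^sup>2 / (v \<bullet> p)"

lemma c: "c > 0" using v_nz vp by (simp add: c_def)

lemma c_vp: "c * (v \<bullet> p) = (v \<bullet> v)\<^sup>2" using vp by (simp add: c_def)

lemma a_inner: "z \<in> V \<Longrightarrow> a \<bullet> z = v \<bullet> A z"
  using sym vV Av by metis

definition I where "I = {w \<in> V. w \<bullet> v = 0}"

lemma subspace_I: "subspace I"
  using V unfolding subspace_def I_def by (auto simp: inner_add_left)

text \<open>Pairing with \<open>v\<close> annihilates the image, since
  \<open>v \<bullet> A z = a \<bullet> z\<close> and \<open>v \<bullet> a = r - \<beta>\<close>.
  Conversely, for \<open>w\<close> orthogonal to \<open>v\<close> the preimage is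
  \<open>P w\<close>: there \<open>a \<bullet> P w = v \<bullet> w = 0\<close>, so the rank-one term
  drops out.\<close>

lemma image_jacobian: "(\<lambda>z. jacobian_matrix (\<lambda>z. \<Phi> z 0 (inverse r)) 0 *v z) ` V = I"
proof
  show "(\<lambda>z. jacobian_matrix (\<lambda>z. \<Phi> z 0 (inverse r)) 0 *v z) ` V \<subseteq> I"
    using r\<beta> av
    by (auto simp: I_def jacobian V AV aV subspace_diff subspace_scale a_inner inner_diff_right
        inner_commute[of _ v])
  show "I \<subseteq> (\<lambda>z. jacobian_matrix (\<lambda>z. \<Phi> z 0 (inverse r)) 0 *v z) ` V"
  proof
    fix w assume w: "w \<in> I"
    then have wV: "w \<in> V" and wv: "w \<bullet> v = 0" by (auto simp: I_def)
    have "a \<bullet> P w = 0" using a_inner[OF P(2)] P(3)[OF wV] wv by (simp add: inner_commute)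
    then show "w \<in> (\<lambda>z. jacobian_matrix (\<lambda>z. \<Phi> z 0 (inverse r)) 0 *v z) ` V"
      using jacobian[OF P(2)[of w]] P(2,3) wV by (intro image_eqI[of _ _ "P w"]) auto
  qed
qed

lemma orth_proj_I_scaleR: "orth_proj I (\<mu> *\<^sub>R v) = 0"
  unfolding orth_proj_characterisation(3)[OF subspace_I] by (auto simp: I_def inner_commute)

text \<open>Inside \<open>V\<close> the orthogonal complement of \<open>I\<close> is the line
  through \<open>v\<close>.\<close>

lemma orth_proj_I_zero_imp:
  assumes "y \<in> V" "orth_proj I y = 0"
  shows "y = ((v \<bullet> y) / (v \<bullet> v)) *\<^sub>R v"
proof -
  define d where "d = y - ((v \<bullet> y) / (v \<bullet> v)) *\<^sub>R v"
  have dv: "d \<bullet> v = 0" using v_nz by (simp add: d_def inner_diff_right inner_diff_left inner_commute)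
  then have "d \<in> I"
    using assms vV V by (simp add: I_def d_def subspace_diff subspace_scale)
  then have "y \<bullet> d = 0"
    using assms(2) by (simp add: orth_proj_characterisation(3)[OF subspace_I])
  then have "d \<bullet> d = 0" using dv by (subst (2) d_def) (simp add: inner_diff_right inner_commute)
  then show ?thesis by (simp add: d_def)
qed

text \<open>The two identities come from pairing with \<open>v\<close> and with \<open>p\<close>. In
  the second, symmetry replaces \<open>p \<bullet> A z\<close> by \<open>v \<bullet> z\<close>, from
  which \<open>W\<close> disappears because it is orthogonal to \<open>v\<close>.\<close>

lemma scalar_equations:
  assumes W: "W \<in> I" and y: "A (x *\<^sub>R v + W) - \<kappa> *\<^sub>R a = \<mu> *\<^sub>R v"
  shows "a \<bullet> (x *\<^sub>R v + W) - \<kappa> * (r - \<beta>) = v \<bullet> \<mu> *\<^sub>R v"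
    and "c * (x - \<kappa>) = v \<bullet> \<mu> *\<^sub>R v"
proof -
  have WV: "W \<in> V" "W \<bullet> v = 0" using W by (auto simp: I_def)
  have z: "x *\<^sub>R v + W \<in> V" using WV vV V by (simp add: subspace_add subspace_scale)
  show "a \<bullet> (x *\<^sub>R v + W) - \<kappa> * (r - \<beta>) = v \<bullet> \<mu> *\<^sub>R v"
    using arg_cong[OF y, of "inner v"] a_inner[OF z] av by (simp add: inner_diff_right inner_commute)
  have "p \<bullet> A (x *\<^sub>R v + W) = x * (v \<bullet> v)"
    using sym[OF p(1) z] p(2) WV by (simp add: inner_add_right inner_commute)
  moreover have "p \<bullet> a = v \<bullet> v"
    using a_inner[OF p(1)] p(2) by (simp add: inner_commute)
  ultimately have "(x - \<kappa>) * (v \<bullet> v) = \<mu> * (v \<bullet> p)"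
    using arg_cong[OF y, of "inner p"] by (simp add: inner_diff_right inner_commute algebra_simps)
  then have "c * ((x - \<kappa>) * (v \<bullet> v)) = \<mu> * (v \<bullet> v)\<^sup>2"
    using c_vp by (metis mult.left_commute)
  then show "c * (x - \<kappa>) = v \<bullet> \<mu> *\<^sub>R v"
    using v_nz by (simp add: power2_eq_square)
qed

text \<open>Substituting the equation for \<open>s\<close> into the first pairing eliminates
  \<open>\<beta>\<close> and gives \<open>f = s - k * r * g s\<close>; comparison with the second
  pairing leaves a closed scalar equation in \<open>s\<close>, \<open>x\<close> and
  \<open>k\<close>. Continuity of \<open>W\<close> supplies the continuity of \<open>s\<close> along
  the reduction.\<close>

lemma LS_reduction_derivatives:
  assumes "LS_reduction \<Phi> V U (inverse r) v f"
  shows "reduction_derivatives g r (\<lambda>x k. f x 0 k)"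
proof -
  obtain W S where S: "open S" "(0, 0, inverse r) \<in> S" and W0: "W 0 0 (inverse r) = 0"
    and contW: "continuous_on {(x, u, k). (x, u, k) \<in> S \<and> u \<in> U} (\<lambda>(x, u, k). W x u k)"
    and WS: "\<And>x u k. (x, u, k) \<in> S \<Longrightarrow> u \<in> U \<Longrightarrow> W x u k \<in> I \<and>
      orth_proj I (\<Phi> (x *\<^sub>R v + W x u k) u k) = 0 \<and> f x u k = v \<bullet> \<Phi> (x *\<^sub>R v + W x u k) u k"
    using assms unfolding LS_reduction_def Let_def image_jacobian by blast
  define \<Omega>1 where "\<Omega>1 = (\<lambda>(x, k). (x, 0 :: real^'n, k)) -` S"
  define z where "z = (\<lambda>x k. x *\<^sub>R v + W x 0 k)"
  define \<Omega>2 where "\<Omega>2 = \<Omega>1 \<inter> (\<lambda>(x, k). (z x k, k)) -` \<Omega>"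
  have op1: "open \<Omega>1"
    unfolding \<Omega>1_def case_prod_unfold by (intro open_vimage S continuous_intros)
  have "continuous_on \<Omega>1 (\<lambda>q. (\<lambda>(x, u, k). W x u k) (fst q, 0, snd q))"
    by (rule continuous_on_compose2[OF contW]) (auto simp: \<Omega>1_def U intro!: continuous_intros)
  then have contz: "continuous_on \<Omega>1 (\<lambda>(x, k). (z x k, k))"
    unfolding z_def case_prod_unfold by (auto intro!: continuous_intros)
  have op2: "open \<Omega>2"
    unfolding \<Omega>2_def by (rule continuous_open_preimage[OF contz op1 \<Omega>(1)])
  have in2: "(0, inverse r) \<in> \<Omega>2"
    using S \<Omega>(2) W0 by (simp add: \<Omega>2_def \<Omega>1_def z_def)
  have zV: "z x k \<in> V" if "(x, k) \<in> \<Omega>2" for x k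
    using that WS[of x 0 k] U V vV by (auto simp: \<Omega>2_def \<Omega>1_def z_def I_def subspace_add subspace_scale)
  have "continuous_on \<Omega>2 (\<lambda>q. (\<lambda>(z, k). s z k) ((\<lambda>(x, k). (z x k, k)) q))"
    by (rule continuous_on_compose2[OF conts continuous_on_subset[OF contz]])
      (use zV in \<open>auto simp: \<Omega>2_def\<close>)
  then have conts2: "continuous_on \<Omega>2 (\<lambda>(x, k). s (z x k) k)"
    by (simp add: case_prod_unfold)
  have eqs: "s (z x k) k - k * (r - c) * g (s (z x k) k) = c * x"
    "f x 0 k = s (z x k) k - k * r * g (s (z x k) k)" if xk: "(x, k) \<in> \<Omega>2" for x k
  proof -
    define \<kappa> where "\<kappa> = k * g (s (z x k) k)"
    have in\<Omega>: "(z x k, k) \<in> \<Omega>" and inS: "(x, 0, k) \<in> S" using xk by (auto simp: \<Omega>2_def \<Omega>1_def)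
    have W: "W x 0 k \<in> I" "orth_proj I (\<Phi> (z x k) 0 k) = 0" "f x 0 k = v \<bullet> \<Phi> (z x k) 0 k"
      using WS[OF inS] U by (auto simp: z_def)
    have \<Phi>z: "\<Phi> (z x k) 0 k = A (z x k) - \<kappa> *\<^sub>R a"
      using \<Phi>[OF in\<Omega> zV[OF xk] U(2)] by (simp add: \<kappa>_def)
    have "\<Phi> (z x k) 0 k \<in> V"
      unfolding \<Phi>z using zV[OF xk] by (simp add: V AV aV subspace_diff subspace_scale)
    from orth_proj_I_zero_imp[OF this W(2)]
    obtain \<mu> where \<mu>: "\<Phi> (z x k) 0 k = \<mu> *\<^sub>R v" by blast
    have "a \<bullet> z x k - \<kappa> * (r - \<beta>) = f x 0 k" "c * (x - \<kappa>) = f x 0 k"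
      using scalar_equations[OF W(1), of x \<kappa> \<mu>] \<Phi>z \<mu> W(3) by (simp_all add: z_def)
    then show "s (z x k) k - k * (r - c) * g (s (z x k) k) = c * x"
      "f x 0 k = s (z x k) k - k * r * g (s (z x k) k)"
      using s_eq[OF in\<Omega> zV[OF xk]] by (simp_all add: \<kappa>_def algebra_simps)
  qed
  show ?thesis
    by (rule reduced_scalar_derivatives[OF dg dg1 dg2 g0 g1 r _ op2 in2 conts2 _ eqs])
      (use c s0 W0 in \<open>auto simp: z_def\<close>)
qed

text \<open>The derivation of the scalar equation is run backwards: solve for the scalar first, then
  recover the multiplier and \<open>W\<close> by explicit formulas.\<close>

lemma LS_reduction_exists: "\<exists>f. LS_reduction \<Phi> V U (inverse r) v f"
proof -
  define k0 where "k0 = inverse r"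
  have cg: "continuous_on UNIV (deriv g)"
    by (meson DERIV_isCont continuous_at_imp_continuous_on dg1)
  have contg: "continuous_on UNIV g"
    by (meson DERIV_isCont continuous_at_imp_continuous_on dg)
  have nz: "1 - k0 * (r - c) \<noteq> 0" "1 - k0 * \<beta> \<noteq> 0"
    using c r r\<beta> by (auto simp: k0_def field_simps)
  obtain \<sigma> T N where T: "open T" "(0, k0) \<in> T" and N: "(0, k0) \<in> N"
    and cont\<sigma>: "continuous_on T (\<lambda>(t, k). \<sigma> t k)"
    and \<sigma>T: "\<And>t k. (t, k) \<in> T \<Longrightarrow> (\<sigma> t k, k) \<in> N \<and> \<sigma> t k - k * (r - c) * g (\<sigma> t k) = t"
    and \<sigma>N: "\<And>s k. (s, k) \<in> N \<Longrightarrow> (s - k * (r - c) * g s, k) \<in> T \<and> \<sigma> (s - k * (r - c) * g s) k = s"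
    by (rule implicit_scalar[OF dg cg g0 g1 nz(1)]) (rule that)
  \<comment> \<open>This second use supplies only injectivity: on \<open>N'\<close> the quantity
    \<open>s - k * \<beta> * g s\<close> determines \<open>s\<close>, so the given \<open>s\<close>
    can be compared with the constructed scalar.\<close>
  obtain \<sigma>' T' N' where N': "open N'" "(0, k0) \<in> N'"
    and \<sigma>N': "\<And>s k. (s, k) \<in> N' \<Longrightarrow> (s - k * \<beta> * g s, k) \<in> T' \<and> \<sigma>' (s - k * \<beta> * g s) k = s"
    by (rule implicit_scalar[OF dg cg g0 g1 nz(2)]) (rule that)
  \<comment> \<open>Eliminating the multiplier from the pairings with \<open>v\<close> and with
    \<open>p\<close>, now with \<open>u\<close> present, gives
    \<open>h - k * (r - c) * g h = t\<close>.\<close>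
  define t where "t = (\<lambda>x u. c * x + v \<bullet> u - c / (v \<bullet> v) * (p \<bullet> u))"
  define h where "h = (\<lambda>x u k. \<sigma> (t x u) k)"
  define \<mu> where "\<mu> = (\<lambda>x u k. (h x u k - k * r * g (h x u k) - v \<bullet> u) / (v \<bullet> v))"
  \<comment> \<open>Applying \<open>P\<close> to \<open>A z = \<mu> v + u + k g(h) a\<close>, with
    \<open>P v = p\<close> and \<open>a = A v\<close>, suggests
    \<open>z = \<mu> p + P u + k g(h) v\<close>; \<open>W\<close> is what remains after subtracting
    \<open>x v\<close>.\<close>
  define W where "W = (\<lambda>x u k. \<mu> x u k *\<^sub>R p + P u + (k * g (h x u k) - x) *\<^sub>R v)"
  define z where "z = (\<lambda>x u k. x *\<^sub>R v + W x u k)"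
  define S1 where "S1 = (\<lambda>(x, u, k). (t x u, k)) -` T"
  define S2 where "S2 = S1 \<inter> (\<lambda>(x, u, k). (z x u k, k)) -` \<Omega>"
  \<comment> \<open>Both the constructed scalar and the value of \<open>s\<close> at the constructed
    state must lie in \<open>N'\<close> before injectivity can equate them.\<close>
  define S3 where "S3 = (S2 \<inter> (\<lambda>(x, u, k). (h x u k, k)) -` N') \<inter> (S2 \<inter> (\<lambda>(x, u, k). (s (z x u k) k, k)) -` N')"
  have contP: "continuous_on X (\<lambda>q. P (fst (snd q)))" for X :: "(real \<times> (real^'n) \<times> real) set"
    by (rule continuous_on_compose2[OF linear_continuous_on[OF P(1)[unfolded linear_conv_bounded_linear], of UNIV]])
      (auto intro!: continuous_intros)
  have op1: "open S1"
    unfolding S1_def case_prod_unfold t_def by (intro open_vimage T continuous_intros)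
  have "continuous_on S1 (\<lambda>q. (\<lambda>(t, k). \<sigma> t k) (t (fst q) (fst (snd q)), snd (snd q)))"
    by (rule continuous_on_compose2[OF cont\<sigma>]) (auto simp: S1_def t_def v_nz intro!: continuous_intros)
  then have conth: "continuous_on S1 (\<lambda>(x, u, k). h x u k)"
    by (simp add: h_def case_prod_unfold)
  have contW: "continuous_on S1 (\<lambda>(x, u, k). W x u k)"
    using conth v_nz contP[of S1] unfolding W_def \<mu>_def case_prod_unfold
    by (auto intro!: continuous_intros continuous_on_compose2[OF contg])
  then have contz: "continuous_on S1 (\<lambda>(x, u, k). (z x u k, k))"
    unfolding z_def case_prod_unfold by (auto intro!: continuous_intros)
  have zV: "z x u k \<in> V" for x u k
    unfolding z_def W_def using V P(2) p(1) vV by (simp add: subspace_add subspace_scale)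
  have op2: "open S2"
    unfolding S2_def by (rule continuous_open_preimage[OF contz op1 \<Omega>(1)])
  have "continuous_on S2 (\<lambda>q. (\<lambda>(z, k). s z k) ((\<lambda>(x, u, k). (z x u k, k)) q))"
    by (rule continuous_on_compose2[OF conts continuous_on_subset[OF contz]])
      (use zV in \<open>auto simp: S2_def\<close>)
  then have conts2: "continuous_on S2 (\<lambda>(x, u, k). (s (z x u k) k, k))"
    unfolding case_prod_unfold by (auto intro!: continuous_intros)
  have conth2: "continuous_on S2 (\<lambda>(x, u, k). (h x u k, k))"
    using continuous_on_subset[OF conth, of S2] unfolding S2_def case_prod_unfold
    by (auto intro!: continuous_intros)
  have op3: "open S3"
    unfolding S3_def
    by (intro open_Int continuous_open_preimage[OF conts2 op2 N'(1)] continuous_open_preimage[OF conth2 op2 N'(1)])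
  have h0: "h 0 0 k0 = 0" using \<sigma>N[OF N] by (simp add: h_def t_def g0)
  have W0: "W 0 0 k0 = 0" using linear_0[OF P(1)] by (simp add: W_def \<mu>_def h0 g0)
  have in3: "(0, 0, k0) \<in> S3"
    using T(2) N'(2) \<Omega>(2) s0 W0 h0 by (simp add: S3_def S2_def S1_def z_def t_def k0_def)
  have main: "W x u k \<in> I \<and> \<Phi> (z x u k) u k = \<mu> x u k *\<^sub>R v" if S: "(x, u, k) \<in> S3" and u: "u \<in> U" for x u k
  proof -
    define \<kappa> where "\<kappa> = k * g (h x u k)"
    have uV: "u \<in> V" using u U by blast
    have inS: "(t x u, k) \<in> T" "(z x u k, k) \<in> \<Omega>" "(h x u k, k) \<in> N'" "(s (z x u k) k, k) \<in> N'"
      using S by (auto simp: S3_def S2_def S1_def)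
    have h_eq: "h x u k - k * (r - c) * g (h x u k) = t x u"
      using \<sigma>T[OF inS(1)] by (simp add: h_def)
    have \<mu>v: "\<mu> x u k * (v \<bullet> v) = h x u k - \<kappa> * r - v \<bullet> u"
      using v_nz by (simp add: \<mu>_def \<kappa>_def)
    have z_eq: "z x u k = \<mu> x u k *\<^sub>R p + P u + \<kappa> *\<^sub>R v"
      by (simp add: z_def W_def \<kappa>_def algebra_simps)
    have Az: "A (z x u k) = \<mu> x u k *\<^sub>R v + u + \<kappa> *\<^sub>R a"
      unfolding z_eq using A P(3)[OF uV] p(2) Av by (simp add: linear_add linear_scale)
    have "v \<bullet> A (z x u k) = \<mu> x u k * (v \<bullet> v) + v \<bullet> u + \<kappa> * (r - \<beta>)"
      unfolding Az av[symmetric] inner_commute[of a v] by (simp add: inner_add_right)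
    then have "a \<bullet> z x u k = h x u k - k * \<beta> * g (h x u k)"
      using a_inner[OF zV] \<mu>v by (simp add: \<kappa>_def algebra_simps)
    then have "s (z x u k) k - k * \<beta> * g (s (z x u k) k) = h x u k - k * \<beta> * g (h x u k)"
      using s_eq[OF inS(2) zV] by simp
    then have "s (z x u k) k = h x u k"
      using \<sigma>N'[OF inS(3)] \<sigma>N'[OF inS(4)] by metis
    then have "\<Phi> (z x u k) u k = \<mu> x u k *\<^sub>R v"
      using \<Phi>[OF inS(2) zV u] Az by (simp add: \<kappa>_def)
    moreover have "W x u k \<in> I"
    proof -
      have "P u \<bullet> v = u \<bullet> p"
        using sym[OF P(2) p(1)] p(2) P(3)[OF uV] by metis
      then have Wv: "W x u k \<bullet> v = \<mu> x u k * (v \<bullet> p) + p \<bullet> u + (\<kappa> - x) * (v \<bullet> v)"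
        by (simp add: W_def \<kappa>_def inner_add_left inner_add_right inner_commute)
      \<comment> \<open>Orthogonality of \<open>W\<close> to \<open>v\<close> is the pairing with
        \<open>p\<close> read backwards: multiply by \<open>v \<bullet> p\<close> and replace
        \<open>c * (v \<bullet> p)\<close> by the square of \<open>v \<bullet> v\<close>.\<close>
      have "\<mu> x u k * (v \<bullet> v) = c * (x - \<kappa>) - c / (v \<bullet> v) * (p \<bullet> u)"
        using h_eq \<mu>v by (simp add: t_def \<kappa>_def algebra_simps)
      then have "\<mu> x u k * (v \<bullet> v) * (v \<bullet> p) = (c * (x - \<kappa>) - c / (v \<bullet> v) * (p \<bullet> u)) * (v \<bullet> p)"
        by simp
      also have "\<dots> = c * (v \<bullet> p) * ((x - \<kappa>) - (p \<bullet> u) / (v \<bullet> v))"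
        by (simp add: algebra_simps)
      finally have "\<mu> x u k * (v \<bullet> v) * (v \<bullet> p) = (v \<bullet> v)\<^sup>2 * ((x - \<kappa>) - (p \<bullet> u) / (v \<bullet> v))"
        by (simp only: c_vp)
      moreover have "(v \<bullet> v)\<^sup>2 * ((x - \<kappa>) - (p \<bullet> u) / (v \<bullet> v)) = ((x - \<kappa>) * (v \<bullet> v) - p \<bullet> u) * (v \<bullet> v)"
        using v_nz by (simp add: power2_eq_square field_simps)
      ultimately have "(\<mu> x u k * (v \<bullet> p) + p \<bullet> u + (\<kappa> - x) * (v \<bullet> v)) * (v \<bullet> v) = 0"
        by (simp add: algebra_simps)
      then have "W x u k \<bullet> v = 0" unfolding Wv using v_nz by simp
      then show ?thesis
        using P(2) p(1) vV V by (simp add: I_def W_def subspace_add subspace_scale)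
    qed
    ultimately show ?thesis by blast
  qed
  show ?thesis
    unfolding LS_reduction_def Let_def image_jacobian
  proof (intro exI[of _ "\<lambda>x u k. v \<bullet> \<Phi> (z x u k) u k"] exI[of _ W] exI[of _ S3] conjI allI impI)
    show "continuous_on {(x, u, k). (x, u, k) \<in> S3 \<and> u \<in> U} (\<lambda>(x, u, k). W x u k)"
      by (rule continuous_on_subset[OF contW]) (auto simp: S3_def S2_def)
  qed (use op3 in3 W0 main orth_proj_I_scaleR in \<open>auto simp: k0_def z_def\<close>)
qed

end

subsection \<open>The network equations\<close>

lemma C_k_function_has_derivative:
  assumes "C_k_function n h" "m < n"
  shows "((deriv ^^ m) h has_real_derivative (deriv ^^ Suc m) h y) (at y)"
  using assms by (auto simp: C_k_function_def DERIV_deriv_iff_real_differentiable)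

lemma jacobian_matrix_mult:
  assumes "(f has_derivative f') (at z)"
  shows "jacobian_matrix f z *v w = f' w"
  using assms by (metis frechet_derivative_at has_derivative_linear jacobian_matrix_def matrix_vector_mul)

lemma edge_vec_inner: "edge_vec a b \<bullet> z = z $ a - z $ b"
  by (simp add: edge_vec_def inner_diff_left inner_axis')

section \<open>Coordinate subspaces of node vectors\<close>

lemma subspace_node_space: "subspace (node_space S)"
  by (auto simp: subspace_def node_space_def)

lemma subspace_ones_perp: "subspace (ones_perp S)"
  using subspace_node_space[of S] by (auto simp: subspace_def ones_perp_def inner_add_left)

lemma linear_node_part: "linear (node_part S)"
  by (rule linearI) (auto simp: node_part_def vec_eq_iff)

lemmas node_part_simps =
  linear_add[OF linear_node_part] linear_diff[OF linear_node_part] linear_scale[OF linear_node_part]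

lemma node_part_in: "node_part S z \<in> node_space S"
  by (simp add: node_part_def node_space_def)

lemma node_part_id: "z \<in> node_space S \<Longrightarrow> node_part S z = z"
  by (auto simp: node_part_def node_space_def vec_eq_iff)

lemma node_space_iff_compl_zero: "z \<in> node_space S \<longleftrightarrow> node_part (- S) z = 0"
  by (auto simp: node_part_def node_space_def vec_eq_iff)

lemma node_part_decomp: "z = node_part S z + node_part (- S) z"
  by (auto simp: node_part_def vec_eq_iff)

lemma node_space_inner_compl: "x \<in> node_space S \<Longrightarrow> y \<in> node_space (- S) \<Longrightarrow> x \<bullet> y = 0"
proof -
  assume "x \<in> node_space S" "y \<in> node_space (- S)"
  then have "x $ a * y $ a = 0" for a by (cases "a \<in> S") (auto simp: node_space_def)
  then show ?thesis unfolding inner_vec_def by (intro sum.neutral) simp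
qed

lemma node_part_inner: "x \<in> node_space S \<Longrightarrow> node_part S y \<bullet> x = y \<bullet> x"
  by (auto simp: node_space_def node_part_def inner_vec_def intro!: sum.cong)

section \<open>The positive Laplacian and the gradient of the potential\<close>

lemma transpose_mult_nth: "(transpose D *v z) $ l = column l D \<bullet> z"
  by (simp add: matrix_vector_mult_def transpose_def column_def inner_vec_def)

lemma positive_laplacian_mult:
  "positive_laplacian D R lm *v z = (\<Sum>l\<in>UNIV - {lm}. (inverse (R l) * (column l D \<bullet> z)) *\<^sub>R column l D)"
proof -
  have "(\<Sum>b\<in>UNIV. (\<Sum>l\<in>UNIV - {lm}. D $ a $ l * inverse (R l) * D $ b $ l) * z $ b)
      = (\<Sum>l\<in>UNIV - {lm}. inverse (R l) * (\<Sum>b\<in>UNIV. D $ b $ l * z $ b) * D $ a $ l)" for a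
    by (simp add: sum_distrib_left sum_distrib_right sum.swap[of _ UNIV] mult_ac)
  then show ?thesis
    by (simp add: vec_eq_iff matrix_vector_mult_def positive_laplacian_def column_def inner_vec_def)
qed

lemma positive_laplacian_inner:
  "(positive_laplacian D R lm *v z) \<bullet> w
     = (\<Sum>l\<in>UNIV - {lm}. inverse (R l) * (column l D \<bullet> z) * (column l D \<bullet> w))"
  by (simp add: positive_laplacian_mult inner_sum_left)

lemma gradient_eqI:
  assumes "(f has_derivative (\<lambda>h. w \<bullet> h)) (at z)"
  shows "gradient f z = w"
  using frechet_derivative_at[OF assms, symmetric]
  by (simp add: gradient_def vec_eq_iff inner_axis)

lemma gradient_potential:
  assumes dG: "\<And>y. (G has_real_derivative g y) (at y)"
  shows "gradient (\<lambda>z. potential_K D R G lm z k) z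
    = positive_laplacian D R lm *v z - (k * g (column lm D \<bullet> z)) *\<^sub>R column lm D"
proof (rule gradient_eqI)
  have gd: "((\<lambda>z. G (column lm D \<bullet> z)) has_derivative (\<lambda>h. (column lm D \<bullet> h) * g (column lm D \<bullet> z))) (at z)"
    by (rule DERIV_compose_FDERIV[OF dG]) (auto intro!: derivative_eq_intros)
  show "((\<lambda>z. potential_K D R G lm z k) has_derivative (\<lambda>h. (positive_laplacian D R lm *v z
      - (k * g (column lm D \<bullet> z)) *\<^sub>R column lm D) \<bullet> h)) (at z)"
    unfolding potential_K_def Let_def transpose_mult_nth inner_diff_left positive_laplacian_inner
    by (auto intro!: derivative_eq_intros gd simp: fun_eq_iff inner_sum_left sum_distrib_left mult_ac
        simp flip: sum.distrib intro!: sum.cong)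
qed

locale network =
  fixes D :: "real^'m::finite^'n::finite"
    and R :: "'m \<Rightarrow> real" and G g :: "real \<Rightarrow> real" and lm :: 'm and i j :: 'n
    and v :: "real^'n" and r :: real and B :: "'n set"
  assumes ij: "i \<noteq> j" and col: "column lm D = edge_vec i j"
    and R: "\<And>l. l \<noteq> lm \<Longrightarrow> R l > 0"
    and C4: "C_k_function 4 G" and g: "g = deriv G" and g0: "g 0 = 0" and g1: "deriv g 0 = 1"
    and conn: "connected_without D lm"
    and inc: "incidence_matrix D"
    and Mv: "positive_laplacian D R lm *v v = edge_vec i j" and vV: "v \<in> ones_perp UNIV"
    and r: "r = v $ i - v $ j"
begin

abbreviation "M \<equiv> positive_laplacian D R lm"
abbreviation "e \<equiv> edge_vec i j"
abbreviation "L0 \<equiv> network_laplacian D R G lm 0 (inverse r)"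

text \<open>The reduction uses three derivatives of \<open>g = G'\<close>, hence four of
  \<open>G\<close>.\<close>

lemma has_derivative_iterate: "m < 4 \<Longrightarrow> ((deriv ^^ m) G has_real_derivative (deriv ^^ Suc m) G y) (at y)"
  by (rule C_k_function_has_derivative[OF C4])

lemma iterate_g: "(deriv ^^ m) g = (deriv ^^ Suc m) G"
  unfolding g funpow_Suc_right by simp

lemma dG: "(G has_real_derivative g y) (at y)"
  using has_derivative_iterate[of 0 y] iterate_g[of 0] by simp

lemma dg: "(g has_real_derivative deriv g y) (at y)"
  using has_derivative_iterate[of 1 y] iterate_g[of 0] by simp

lemma dg1: "(deriv g has_real_derivative (deriv ^^ 2) g y) (at y)"
  using has_derivative_iterate[of 2 y] iterate_g[of 1] iterate_g[of 2] by (simp add: numeral_2_eq_2)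

lemma dg2: "((deriv ^^ 2) g has_real_derivative (deriv ^^ 3) g y) (at y)"
  using has_derivative_iterate[of 3 y] iterate_g[of 2] iterate_g[of 3] by (simp add: numeral_2_eq_2 numeral_3_eq_3)

lemma grad: "gradient (\<lambda>z. potential_K D R G lm z k) z = M *v z - (k * g (e \<bullet> z)) *\<^sub>R e"
  using gradient_potential[of G g D R lm k z] dG by (simp add: col)

lemma M_sym: "(M *v z) \<bullet> w = z \<bullet> (M *v w)"
  by (simp add: positive_laplacian_inner inner_commute[of z] mult_ac)

lemma M_one: "M *v 1 = 0"
proof -
  have "column l D \<bullet> 1 = 0" for l
    using inc unfolding incidence_matrix_def by (metis edge_vec_inner one_index diff_self)
  then show ?thesis by (simp add: positive_laplacian_mult)
qed

lemma M_nonneg: "(M *v z) \<bullet> z \<ge> 0"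
  unfolding positive_laplacian_inner using R
  by (intro sum_nonneg) (auto simp: mult.assoc less_imp_le intro!: mult_nonneg_nonneg)

text \<open>The energy is a sum of nonnegative edge terms, so zero energy means equal potentials
  across every remaining edge. Connectedness carries the value at \<open>i\<close> to all
  nodes.\<close>

lemma M_zero:
  assumes "(M *v z) \<bullet> z = 0"
  obtains t where "z = t *\<^sub>R 1"
proof -
  have nn: "0 \<le> inverse (R l) * (column l D \<bullet> z) * (column l D \<bullet> z)" if "l \<in> UNIV - {lm}" for l
    using R[of l] that by (simp add: mult.assoc less_imp_le)
  have z0: "\<forall>l\<in>UNIV - {lm}. inverse (R l) * (column l D \<bullet> z) * (column l D \<bullet> z) = 0"
    using assms unfolding positive_laplacian_inner
    by (subst (asm) sum_nonneg_eq_0_iff) (fact finite, fact nn)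
  have cz: "column l D \<bullet> z = 0" if "l \<noteq> lm" for l
    using bspec[OF z0, of l] R[OF that] that by simp
  have "z $ b = z $ i" for b
  proof -
    have "(i, b) \<in> {(c, d). \<exists>l. l \<noteq> lm \<and> (column l D = edge_vec c d \<or> column l D = edge_vec d c)}\<^sup>*"
      using conn by (simp add: connected_without_def)
    then show ?thesis
    proof (induction rule: rtrancl_induct)
      case (step c d)
      then obtain l where "l \<noteq> lm" "column l D = edge_vec c d \<or> column l D = edge_vec d c" by auto
      then have "z $ c = z $ d" using cz[of l] by (auto simp: edge_vec_inner)
      then show ?case using step by simp
    qed simp
  qed
  then show ?thesis using that[of "z $ i"] by (simp add: vec_eq_iff)
qed

lemma M_pos:
  assumes "z \<in> ones_perp UNIV" "z \<noteq> 0"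
  shows "(M *v z) \<bullet> z > 0"
proof (rule ccontr)
  assume "\<not> ?thesis"
  then have "(M *v z) \<bullet> z = 0" using M_nonneg[of z] by simp
  then obtain t where t: "z = t *\<^sub>R 1" by (rule M_zero)
  have "z \<bullet> z = t * (z \<bullet> 1)" by (subst (2) t) simp
  then show False using assms by (simp add: ones_perp_def)
qed

lemma v_nz: "v \<noteq> 0"
proof
  assume "v = 0"
  then have "e \<bullet> axis i 1 = 0" using Mv by simp
  then show False using ij by (simp add: edge_vec_inner axis_def)
qed

lemma e_v: "e \<bullet> v = r" by (simp add: edge_vec_inner r)

text \<open>The effective resistance is the energy of \<open>v\<close>:
  \<open>r = e \<bullet> v = (M *v v) \<bullet> v\<close>.\<close>

lemma r_pos: "r > 0"
  using M_pos[OF vV v_nz] by (simp add: Mv e_v)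

lemma e_one: "e \<bullet> 1 = 0" by (simp add: edge_vec_inner)

lemma L0_mult: "L0 *v w = M *v w - (inverse r * (e \<bullet> w)) *\<^sub>R e"
  unfolding network_laplacian_def
proof (rule jacobian_matrix_mult)
  have gd: "((\<lambda>z. g (e \<bullet> z)) has_derivative (\<lambda>h. (e \<bullet> h) * deriv g (e \<bullet> 0))) (at 0)"
    by (rule DERIV_compose_FDERIV[OF dg]) (auto intro!: derivative_eq_intros)
  have Md: "((\<lambda>z. M *v z) has_derivative (\<lambda>h. M *v h)) (at 0)"
    by (rule bounded_linear_imp_has_derivative) (simp add: matrix_vector_mul_bounded_linear)
  show "(gradient (\<lambda>z. potential_K D R G lm z (inverse r)) has_derivative
      (\<lambda>w. M *v w - (inverse r * (e \<bullet> w)) *\<^sub>R e)) (at 0)"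
    unfolding grad[abs_def]
    by (auto intro!: derivative_eq_intros gd Md simp: g1)
qed

text \<open>For a kernel vector \<open>w\<close>, \<open>M *v w\<close> is a multiple of
  \<open>e = M *v v\<close>; subtracting that multiple of \<open>v\<close> leaves a vector in the
  kernel of \<open>M\<close>, which is constant. Conversely \<open>v\<close> is critical because
  \<open>e \<bullet> v = r\<close> cancels the gain \<open>inverse r\<close>.\<close>

lemma ker_L0: "{w. L0 *v w = 0} = span {1, v}"
proof (intro subset_antisym subsetI)
  fix w assume "w \<in> {w. L0 *v w = 0}"
  then have "M *v w = M *v ((inverse r * (e \<bullet> w)) *\<^sub>R v)"
    by (simp add: L0_mult Mv matrix_vector_mult_scaleR)
  then have "(M *v (w - (inverse r * (e \<bullet> w)) *\<^sub>R v)) = 0"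
    by (simp add: matrix_vector_mult_diff_distrib)
  then obtain t where "w - (inverse r * (e \<bullet> w)) *\<^sub>R v = t *\<^sub>R 1"
    by (metis M_zero inner_zero_left)
  then have "w = t *\<^sub>R 1 + (inverse r * (e \<bullet> w)) *\<^sub>R v" by (simp add: algebra_simps)
  then show "w \<in> span {1, v}"
    by (metis insertI1 insertI2 singletonI span_add span_base span_scale)
next
  fix w assume "w \<in> span {1, v}"
  moreover have "span {1, v} \<subseteq> {w. L0 *v w = 0}"
  proof (rule span_minimal)
    show "subspace {w. L0 *v w = 0}" by (rule linear_subspace_kernel) simp
    show "{1, v} \<subseteq> {w. L0 *v w = 0}"
      using r_pos by (simp add: L0_mult M_one e_one Mv e_v)
  qed
  ultimately show "w \<in> {w. L0 *v w = 0}" by blast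
qed

lemma singular: "singular_network D R G lm 0 0 (inverse r)"
proof -
  have v1: "v \<bullet> 1 = 0" using vV by (simp add: ones_perp_def)
  have "(1 :: real^'n) \<noteq> 0" by (simp add: vec_eq_iff)
  moreover have "v \<noteq> 1" using v1 v_nz by (metis inner_eq_zero_iff)
  ultimately have "independent {1, v}"
    using v1 v_nz by (intro pairwise_orthogonal_independent)
      (auto simp: pairwise_def orthogonal_def inner_commute)
  then have "dim (span {1, v}) = 2"
    using \<open>v \<noteq> 1\<close> by (simp add: dim_eq_card_independent)
  then show ?thesis
    by (simp add: singular_network_def network_F_def grad g0 ker_L0)
qed

text \<open>With \<open>\<beta> = 0\<close> the scalar equation is just
  \<open>s = e \<bullet> z\<close>, so no localisation is required.\<close>

lemma full_rank_one_reduction: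
  "rank_one_reduction (ones_perp UNIV) (ones_perp B) (\<lambda>z. M *v z) e v g r 0
     (network_F D R G lm) (\<lambda>z k. e \<bullet> z) UNIV"
proof (rule rank_one_reduction.intro)
  show "ones_perp B \<subseteq> ones_perp UNIV" by (auto simp: ones_perp_def node_space_def)
  show "0 \<in> ones_perp B" by (simp add: subspace_ones_perp subspace_0)
  show "linear (\<lambda>z. M *v z)" by simp
  show "M *v z \<in> ones_perp UNIV" if "z \<in> ones_perp UNIV" for z
    by (simp add: ones_perp_def node_space_def M_sym M_one)
  show "(M *v y) \<bullet> z = y \<bullet> (M *v z)" for y z by (rule M_sym)
  show "e \<bullet> v = r - 0" "r \<noteq> 0" "r \<noteq> 0" using e_v r_pos by auto
  show "continuous_on {(z, k). (z, k) \<in> UNIV \<and> z \<in> ones_perp UNIV} (\<lambda>(z, k :: real). e \<bullet> z)"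
    unfolding case_prod_unfold by (intro continuous_intros)
  show "network_F D R G lm z u k = M *v z - (k * g (e \<bullet> z)) *\<^sub>R e - u" for z u k
    by (simp add: network_F_def grad)
  show "jacobian_matrix (\<lambda>z. network_F D R G lm z 0 (inverse r)) 0 *v z = M *v z - (e \<bullet> z / (r - 0)) *\<^sub>R e" for z
    using L0_mult[of z] by (simp add: network_F_def network_laplacian_def divide_inverse mult.commute)
qed (rule subspace_ones_perp M_pos vV Mv dg dg1 dg2 g0 g1 | assumption | simp)+

end

subsection \<open>Eliminating the central nodes\<close>

locale reduced_network = network D R G g lm i j v r B
  for D :: "real^'m::finite^'n::finite" and R G g lm and i j :: 'n and v r B +
  assumes block: "block_invertible (network_laplacian D R G lm 0 (inverse r)) (- B)"
begin

abbreviation "C \<equiv> node_space (- B)"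

lemma block_inj:
  assumes "w \<in> C" "node_part (- B) (L0 *v w) = 0"
  shows "w = 0"
proof -
  have "inj_on (\<lambda>w. node_part (- B) (L0 *v w)) C"
    using block by (simp add: block_invertible_def bij_betw_def)
  moreover have "node_part (- B) (L0 *v 0) = 0" by (simp add: node_part_def vec_eq_iff)
  moreover have "0 \<in> C" by (simp add: subspace_node_space subspace_0)
  ultimately show ?thesis using assms by (metis inj_onD)
qed

text \<open>Without boundary nodes the central block would be all of \<open>L0\<close>, which has
  \<open>v\<close> in its kernel.\<close>

lemma B_nonempty: "\<exists>b. b \<in> B"
proof (rule ccontr)
  assume "\<not> ?thesis"
  then have "v \<in> C" by (simp add: node_space_def)
  moreover have "L0 *v v = 0" using ker_L0 by (auto intro: span_base)
  ultimately show False using block_inj[of v] v_nz by (simp add: node_part_def vec_eq_iff)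
qed

text \<open>A central vector annihilated by the block has zero energy, so it is constant; it
  vanishes at a boundary node.\<close>

lemma M_block_inj:
  assumes w: "w \<in> C" and "node_part (- B) (M *v w) = 0"
  shows "w = 0"
proof -
  have "(M *v w) \<bullet> w = 0" using node_part_inner[OF w, of "M *v w"] assms(2) by simp
  then obtain t where t: "w = t *\<^sub>R 1" by (rule M_zero)
  obtain b where "b \<in> B" using B_nonempty by blast
  then have "w $ b = 0" using w by (simp add: node_space_def)
  then show ?thesis using t by simp
qed

lemma linear_block: "linear (\<lambda>w. node_part S (M *v w))"
  using linear_compose[OF _ linear_node_part, of "\<lambda>w. M *v w"] by (simp add: o_def)

definition Q where
  "Q = (SOME Q. linear Q \<and> (\<forall>w. Q w \<in> C) \<and> (\<forall>w\<in>C. node_part (- B) (M *v (Q w)) = w))"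

lemma Q: "linear Q" "Q w \<in> C" "w \<in> C \<Longrightarrow> node_part (- B) (M *v (Q w)) = w"
proof -
  have "\<exists>Q. linear Q \<and> (\<forall>w. Q w \<in> C) \<and> (\<forall>w\<in>C. node_part (- B) (M *v (Q w)) = w)"
    using linear_inverse_on_subspace[OF subspace_node_space linear_block node_part_in M_block_inj]
    by metis
  from someI_ex[OF this]
  show "linear Q" "Q w \<in> C" "w \<in> C \<Longrightarrow> node_part (- B) (M *v (Q w)) = w"
    unfolding Q_def by blast+
qed

text \<open>With \<open>Q\<close> the inverse of the central block of \<open>M\<close>,
  \<open>H\<close> extends boundary potentials so that no current enters at the central nodes, and
  \<open>A\<close> is the Schur complement (Kron reduction) of \<open>M\<close>. Likewise
  \<open>a\<close> is the edge vector after elimination, and \<open>\<beta>\<close> is the quadratic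
  form of \<open>Q\<close> at the central part of \<open>e\<close>.\<close>

definition q where "q = Q (node_part (- B) e)"
definition H where "H z = z - Q (node_part (- B) (M *v z))"
definition A where "A z = M *v H z"
definition a where "a = e - M *v q"
definition \<beta> where "\<beta> = e \<bullet> q"

lemma q: "q \<in> C" "node_part (- B) (M *v q) = node_part (- B) e"
  using Q node_part_in by (auto simp: q_def)

lemma H_diff: "z - H z \<in> C"
  using Q(2) by (simp add: H_def)

lemma linear_H: "linear H"
  unfolding H_def by (intro linear_compose_sub linear_ident linear_compose[OF linear_block Q(1), unfolded o_def])

lemma linear_A: "linear A"
  unfolding A_def using linear_compose[OF linear_H, of "\<lambda>w. M *v w"] by (simp add: o_def)

lemma A_in: "A z \<in> node_space B"
  unfolding node_space_iff_compl_zero A_def H_def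
  using Q(3)[OF node_part_in] by (simp add: matrix_vector_mult_diff_distrib node_part_simps)

lemma a_in: "a \<in> node_space B"
  unfolding node_space_iff_compl_zero a_def using q by (simp add: node_part_simps)

lemma inner_H:
  assumes "x \<in> node_space B"
  shows "x \<bullet> H z = x \<bullet> z"
  using node_space_inner_compl[OF assms H_diff[of z]] by (simp add: inner_diff_right)

text \<open>\<open>A y\<close> is supported on \<open>B\<close>, where \<open>z\<close> and
  \<open>H z\<close> agree. Thus \<open>A\<close> carries the energy form of the extended
  potentials, and symmetry and positivity descend from \<open>M\<close>.\<close>

lemma A_inner: "A y \<bullet> z = (M *v H y) \<bullet> H z"
  using inner_H[OF A_in] by (simp add: A_def)

lemma A_sym: "A y \<bullet> z = y \<bullet> A z"
  using A_inner[of y z] A_inner[of z y] M_sym[of "H y" "H z"] by (simp add: inner_commute)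

text \<open>The correction \<open>q \<bullet> A z\<close> vanishes, as \<open>q\<close> is central
  and \<open>A z\<close> lives on the boundary.\<close>

lemma a_inner: "a \<bullet> z = e \<bullet> H z"
proof -
  have "a \<bullet> z = e \<bullet> H z - q \<bullet> A z"
    using inner_H[OF a_in, of z] M_sym[of q "H z"] by (simp add: a_def A_def inner_diff_left)
  moreover have "q \<bullet> A z = 0"
    using node_space_inner_compl[OF A_in q(1)] by (simp add: inner_commute)
  ultimately show ?thesis by simp
qed

text \<open>For fixed \<open>\<kappa>\<close> the central equation is linear with at most one
  solution, by \<open>M_block_inj\<close>. It is used with \<open>\<kappa> = 0\<close> for the
  constants, \<open>\<kappa> = 1\<close> for \<open>v\<close> and \<open>\<kappa> = k * g s\<close>
  for the nonlinear network.\<close>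

lemma eq_H_plus:
  assumes "z \<in> C" and zB: "zB \<in> node_space B"
    and M: "node_part (- B) (M *v (zB + z)) = \<kappa> *\<^sub>R node_part (- B) e"
  shows "zB + z = H zB + \<kappa> *\<^sub>R q"
proof -
  define w where "w = zB + z - (H zB + \<kappa> *\<^sub>R q)"
  have "w = (zB - H zB) + z - \<kappa> *\<^sub>R q" by (simp add: w_def)
  moreover have "zB - H zB + z - \<kappa> *\<^sub>R q \<in> C"
    by (rule subspace_diff subspace_add H_diff subspace_scale subspace_node_space assms(1) q)+
  ultimately have "w \<in> C" by simp
  moreover have "node_part (- B) (M *v w) = 0"
    using M q(2) A_in[of zB] unfolding node_space_iff_compl_zero
    by (simp add: w_def A_def matrix_vector_mult_diff_distrib matrix_vector_right_distrib
        matrix_vector_mult_scaleR node_part_simps)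
  ultimately have "w = 0" by (rule M_block_inj)
  then show ?thesis by (simp add: w_def)
qed

section \<open>The critical vector of the reduced equations\<close>

abbreviation "vB \<equiv> orth_proj (ones_perp B) (node_part B v)"
abbreviation "oneB \<equiv> node_part B 1"

lemma H_oneB: "H oneB = 1"
proof -
  have "(1 :: real^'n) = oneB + node_part (- B) 1" by (rule node_part_decomp)
  moreover have "oneB + node_part (- B) 1 = H oneB + 0 *\<^sub>R q"
    by (rule eq_H_plus[OF node_part_in node_part_in])
      (simp add: M_one node_part_simps flip: node_part_decomp, simp add: node_part_def vec_eq_iff)
  ultimately show ?thesis by simp
qed

lemma A_oneB: "A oneB = 0"
  by (simp add: A_def H_oneB M_one)

lemma H_v: "v = H (node_part B v) + q"
proof -
  have "node_part B v + node_part (- B) v = H (node_part B v) + 1 *\<^sub>R q"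
    by (rule eq_H_plus[OF node_part_in node_part_in]) (simp add: Mv flip: node_part_decomp)
  then show ?thesis by (simp flip: node_part_decomp)
qed

lemma A_vB': "A (node_part B v) = a"
  using arg_cong[OF H_v, of "\<lambda>w. M *v w"] by (simp add: A_def a_def Mv matrix_vector_right_distrib)

lemma ones_perp_oneB: "z \<in> ones_perp B \<Longrightarrow> oneB \<bullet> z = 0"
  using node_part_inner[of z B 1] by (auto simp: ones_perp_def inner_commute)

lemma oneB_nz: "oneB \<bullet> oneB \<noteq> 0"
proof -
  obtain b where "b \<in> B" using B_nonempty by blast
  then have "oneB $ b = 1" by (simp add: node_part_def)
  then show ?thesis by (metis inner_eq_zero_iff zero_index zero_neq_one)
qed

text \<open>The projection only subtracts a multiple of \<open>oneB\<close>, which both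
  \<open>A\<close> and the pairing with \<open>a\<close> annihilate; so \<open>A vB\<close> and
  \<open>a \<bullet> vB\<close> can be computed from the boundary part of \<open>v\<close>.\<close>

lemma vB_eq: "\<exists>m. vB = node_part B v - m *\<^sub>R oneB" "vB \<in> ones_perp B"
proof -
  define m where "m = (node_part B v \<bullet> oneB) / (oneB \<bullet> oneB)"
  have "(node_part B v - m *\<^sub>R oneB) \<bullet> oneB = 0"
    using oneB_nz by (simp add: m_def inner_diff_left)
  moreover have "node_part B v - m *\<^sub>R oneB \<in> node_space B"
    using subspace_node_space node_part_in by (intro subspace_diff subspace_scale)
  ultimately have "node_part B v - m *\<^sub>R oneB \<in> ones_perp B"
    using node_part_inner[of "node_part B v - m *\<^sub>R oneB" B 1] by (simp add: ones_perp_def inner_commute)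
  then have "vB = node_part B v - m *\<^sub>R oneB"
    by (rule orth_proj_eqI[OF subspace_ones_perp]) (simp add: ones_perp_oneB)
  then show "\<exists>m. vB = node_part B v - m *\<^sub>R oneB" by blast
  show "vB \<in> ones_perp B" by (rule orth_proj_characterisation(1)[OF subspace_ones_perp])
qed

lemma A_vB: "A vB = a"
  using vB_eq(1) by (auto simp: linear_diff[OF linear_A] linear_scale[OF linear_A] A_vB' A_oneB)

lemma a_vB: "a \<bullet> vB = r - \<beta>"
proof -
  have "a \<bullet> oneB = 0" by (simp add: a_inner H_oneB e_one)
  then have "a \<bullet> vB = a \<bullet> node_part B v" using vB_eq(1) by (auto simp: inner_diff_right)
  also have "\<dots> = e \<bullet> (v - q)" using H_v by (metis a_inner add_diff_cancel_right')
  finally show ?thesis by (simp add: e_v \<beta>_def inner_diff_right)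
qed

text \<open>If \<open>r = \<beta>\<close>, then \<open>L0 *v q\<close> has zero central part, so the
  block hypothesis on \<open>L0\<close> forces \<open>q = 0\<close>, hence
  \<open>\<beta> = 0\<close>, against \<open>r > 0\<close>.\<close>

lemma r_neq_beta: "r \<noteq> \<beta>"
proof
  assume r\<beta>: "r = \<beta>"
  have "node_part (- B) (L0 *v q) = 0"
    unfolding L0_mult using q(2) r_pos r\<beta> by (simp add: \<beta>_def node_part_simps)
  then have "q = 0" using block_inj q(1) by blast
  then show False using r\<beta> r_pos by (simp add: \<beta>_def)
qed

text \<open>Zero energy makes \<open>H z\<close> constant, and then
  \<open>z \<bullet> z = z \<bullet> H z\<close> is a multiple of
  \<open>z \<bullet> 1 = 0\<close>.\<close>

lemma A_pos:
  assumes z: "z \<in> ones_perp B" "z \<noteq> 0"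
  shows "A z \<bullet> z > 0"
proof (rule ccontr)
  assume "\<not> ?thesis"
  then have "(M *v H z) \<bullet> H z = 0" using A_inner M_nonneg[of "H z"] by simp
  then obtain t where t: "H z = t *\<^sub>R 1" by (rule M_zero)
  have "z \<in> node_space B" using z by (simp add: ones_perp_def)
  then have "z \<bullet> z = z \<bullet> H z" by (simp add: inner_H)
  then have "z \<bullet> z = 0" using z by (simp add: t ones_perp_def)
  then show False using z by simp
qed

lemma A_ones_perp: "A z \<in> ones_perp B"
proof -
  have "A z \<bullet> 1 = 0" using M_sym[of "H z" 1] by (simp add: A_def M_one)
  then show ?thesis using A_in by (simp add: ones_perp_def)
qed

text \<open>By \<open>eq_H_plus\<close> a central solution depends on the nonlinearity only through
  \<open>k * g s\<close>; pairing with \<open>e\<close> closes the equation for \<open>s\<close>.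
  The argument is pointwise, so it covers every choice of \<open>zC\<close>.\<close>

lemma central_solution_imp:
  assumes zB: "zB \<in> node_space B" and zC: "zC \<in> C"
    and zero: "node_part (- B) (gradient (\<lambda>z. potential_K D R G lm z k) (zB + zC)) = 0"
  defines "s \<equiv> e \<bullet> (zB + zC)"
  shows "s - k * \<beta> * g s = a \<bullet> zB"
    and "node_part B (gradient (\<lambda>z. potential_K D R G lm z k) (zB + zC)) = A zB - (k * g s) *\<^sub>R a"
proof -
  have "node_part (- B) (M *v (zB + zC)) = (k * g s) *\<^sub>R node_part (- B) e"
    using zero by (simp add: grad s_def node_part_simps)
  then have eq: "zB + zC = H zB + (k * g s) *\<^sub>R q" by (rule eq_H_plus[OF zC zB])
  have "s = e \<bullet> H zB + k * g s * \<beta>"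
    using arg_cong[OF eq, of "inner e"] unfolding s_def[symmetric] by (simp add: \<beta>_def inner_add_right)
  then show "s - k * \<beta> * g s = a \<bullet> zB" by (simp add: a_inner algebra_simps)
  have "gradient (\<lambda>z. potential_K D R G lm z k) (zB + zC) = M *v (zB + zC) - (k * g s) *\<^sub>R e"
    by (simp add: grad s_def)
  also have "\<dots> = A zB - (k * g s) *\<^sub>R a"
    unfolding eq by (simp add: A_def a_def matrix_vector_right_distrib matrix_vector_mult_scaleR algebra_simps)
  finally have "gradient (\<lambda>z. potential_K D R G lm z k) (zB + zC) = A zB - (k * g s) *\<^sub>R a" .
  then show "node_part B (gradient (\<lambda>z. potential_K D R G lm z k) (zB + zC)) = A zB - (k * g s) *\<^sub>R a"
    using A_in a_in by (simp add: node_part_id node_part_simps)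
qed

lemma continuous_deriv_g: "continuous_on UNIV (deriv g)"
  by (meson DERIV_isCont continuous_at_imp_continuous_on dg1)

lemma beta_nz: "1 - inverse r * \<beta> \<noteq> 0"
  using r_neq_beta r_pos by (simp add: field_simps)

lemma central_solution_exists: "\<exists>zC. central_solution D R G lm B (inverse r) zC"
proof -
  obtain \<sigma> T N where T: "open T" "(0, inverse r) \<in> T" and N: "(0, inverse r) \<in> N"
    and cont\<sigma>: "continuous_on T (\<lambda>(t, k). \<sigma> t k)"
    and \<sigma>T: "\<And>t k. (t, k) \<in> T \<Longrightarrow> (\<sigma> t k, k) \<in> N \<and> \<sigma> t k - k * \<beta> * g (\<sigma> t k) = t"
    and \<sigma>N: "\<And>s k. (s, k) \<in> N \<Longrightarrow> (s - k * \<beta> * g s, k) \<in> T \<and> \<sigma> (s - k * \<beta> * g s) k = s"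
    by (rule implicit_scalar[OF dg continuous_deriv_g g0 g1 beta_nz]) (rule that)
  define s where "s = (\<lambda>zB k. \<sigma> (a \<bullet> zB) k)"
  \<comment> \<open>This is \<open>eq_H_plus\<close> solved for the central part, with
    \<open>s\<close> supplied by the scalar branch at \<open>a \<bullet> zB\<close>.\<close>
  define zC where "zC = (\<lambda>zB k. H zB - zB + (k * g (s zB k)) *\<^sub>R q)"
  define S where "S = (\<lambda>(zB, k). (a \<bullet> zB, k)) -` T"
  have contg: "continuous_on UNIV g"
    by (meson DERIV_isCont continuous_at_imp_continuous_on dg)
  have "open S"
    unfolding S_def case_prod_unfold by (intro open_vimage T continuous_intros)
  moreover have "(0, inverse r) \<in> S" using T by (simp add: S_def)
  moreover have "\<sigma> 0 (inverse r) = 0" using \<sigma>N[OF N] by (simp add: g0)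
  then have "zC 0 (inverse r) = 0"
    by (simp add: zC_def s_def g0 linear_0[OF linear_H])
  moreover have "continuous_on {(zB, k). (zB, k) \<in> S \<and> zB \<in> node_space B} (\<lambda>(zB, k). zC zB k)"
  proof -
    have "continuous_on S (\<lambda>q. (\<lambda>(t, k). \<sigma> t k) (a \<bullet> fst q, snd q))"
      by (rule continuous_on_compose2[OF cont\<sigma>]) (auto simp: S_def intro!: continuous_intros)
    then have conts: "continuous_on S (\<lambda>q. s (fst q) (snd q))" by (simp add: s_def)
    have "continuous_on S (\<lambda>q. H (fst q))"
      by (rule continuous_on_compose2[OF linear_continuous_on[OF linear_H[unfolded linear_conv_bounded_linear], of UNIV]])
        (auto intro!: continuous_intros)
    then have "continuous_on S (\<lambda>(zB, k). zC zB k)"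
      unfolding zC_def case_prod_unfold
      by (auto intro!: continuous_intros continuous_on_compose2[OF contg] conts)
    then show ?thesis by (rule continuous_on_subset) auto
  qed
  moreover have "zC zB k \<in> C \<and> node_part (- B) (gradient (\<lambda>z. potential_K D R G lm z k) (zB + zC zB k)) = 0"
    if "(zB, k) \<in> S" for zB k
  proof -
    have s_eq: "s zB k = a \<bullet> zB + k * g (s zB k) * \<beta>"
      using \<sigma>T[of "a \<bullet> zB" k] that by (simp add: S_def s_def algebra_simps)
    have eq: "zB + zC zB k = H zB + (k * g (s zB k)) *\<^sub>R q" by (simp add: zC_def)
    then have es: "e \<bullet> (zB + zC zB k) = s zB k"
      using s_eq by (simp add: inner_add_right a_inner \<beta>_def)
    have "H zB - zB \<in> C" using subspace_neg[OF subspace_node_space Q(2)] by (simp add: H_def)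
    then have "zC zB k \<in> C"
      unfolding zC_def by (intro subspace_add subspace_scale subspace_node_space q(1))
    moreover have "node_part (- B) (M *v H zB) = 0"
      using A_in[of zB] unfolding node_space_iff_compl_zero A_def .
    ultimately show ?thesis
      unfolding grad es unfolding eq using q(2)
      by (simp add: matrix_vector_right_distrib matrix_vector_mult_scaleR node_part_simps)
  qed
  ultimately show ?thesis unfolding central_solution_def by blast
qed

lemma reduced_rank_one_reduction:
  assumes "central_solution D R G lm B (inverse r) zC"
  shows "\<exists>\<Omega>. rank_one_reduction (ones_perp B) (ones_perp B) A a vB g r \<beta>
     (reduced_F D R G lm B zC) (\<lambda>z k. e \<bullet> (node_part B z + zC (node_part B z) k)) \<Omega>"
proof -
  obtain S where S: "open S" "(0, inverse r) \<in> S" and zC0: "zC 0 (inverse r) = 0"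
    and contzC: "continuous_on {(zB, k). (zB, k) \<in> S \<and> zB \<in> node_space B} (\<lambda>(zB, k). zC zB k)"
    and zC: "\<And>zB k. (zB, k) \<in> S \<Longrightarrow> zB \<in> node_space B \<Longrightarrow> zC zB k \<in> C \<and>
      node_part (- B) (gradient (\<lambda>z. potential_K D R G lm z k) (zB + zC zB k)) = 0"
    using assms unfolding central_solution_def by blast
  define s where "s = (\<lambda>z k. e \<bullet> (node_part B z + zC (node_part B z) k))"
  have bl: "bounded_linear (node_part B)"
    using linear_node_part[of B] by (simp add: linear_conv_bounded_linear)
  define \<Omega> where "\<Omega> = (\<lambda>(z, k). (node_part B z, k)) -` S"
  have op\<Omega>: "open \<Omega>"
    unfolding \<Omega>_def case_prod_unfold
    by (intro open_vimage S continuous_intros bounded_linear.continuous_on[OF bl])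
  have "continuous_on \<Omega> (\<lambda>q. (\<lambda>(zB, k). zC zB k) (node_part B (fst q), snd q))"
    by (rule continuous_on_compose2[OF contzC])
      (auto simp: \<Omega>_def node_part_in intro!: continuous_intros bounded_linear.continuous_on[OF bl])
  then have conts: "continuous_on \<Omega> (\<lambda>(z, k). s z k)"
    unfolding s_def case_prod_unfold
    by (auto intro!: continuous_intros bounded_linear.continuous_on[OF bl])
  have s_eq: "s z k - k * \<beta> * g (s z k) = a \<bullet> node_part B z"
    and \<Phi>: "reduced_F D R G lm B zC z u k = A (node_part B z) - (k * g (s z k)) *\<^sub>R a - u"
    if "(z, k) \<in> \<Omega>" for z k u
    using central_solution_imp[where zB = "node_part B z" and zC = "zC (node_part B z) k" and k = k, OF node_part_in] zC[of "node_part B z" k] that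
    by (simp_all add: \<Omega>_def s_def node_part_in reduced_F_def Let_def)
  have in\<Omega>: "(0, inverse r) \<in> \<Omega>"
    using S(2) by (simp add: \<Omega>_def linear_0[OF linear_node_part])
  have s0: "s 0 (inverse r) = 0"
    by (simp add: s_def linear_0[OF linear_node_part] zC0)
  have jac: "jacobian_matrix (\<lambda>z. reduced_F D R G lm B zC z 0 (inverse r)) 0 *v z
      = A (node_part B z) - ((a \<bullet> node_part B z) / (r - \<beta>)) *\<^sub>R a" for z
  proof -
    \<comment> \<open>The given \<open>zC\<close> is merely continuous, so \<open>s\<close> is first
      identified with the branch \<open>\<sigma>\<close> near \<open>0\<close>; its derivative then
      comes from \<open>implicit_scalar\<close>.\<close>
    obtain \<sigma> T N where T: "open T" "(0, inverse r) \<in> T" and N: "open N" "(0, inverse r) \<in> N"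
      and "continuous_on T (\<lambda>(t, k). \<sigma> t k)"
      and \<sigma>T: "\<And>t k. (t, k) \<in> T \<Longrightarrow> (\<sigma> t k, k) \<in> N \<and> \<sigma> t k - k * \<beta> * g (\<sigma> t k) = t"
      and \<sigma>N: "\<And>s k. (s, k) \<in> N \<Longrightarrow> (s - k * \<beta> * g s, k) \<in> T \<and> \<sigma> (s - k * \<beta> * g s) k = s"
      and "\<And>s k. (s, k) \<in> N \<Longrightarrow> 1 - k * \<beta> * deriv g s \<noteq> 0"
      and d\<sigma>: "\<And>t k. (t, k) \<in> T \<Longrightarrow>
         ((\<lambda>t. \<sigma> t k) has_real_derivative inverse (1 - k * \<beta> * deriv g (\<sigma> t k))) (at t)"
      by (rule implicit_scalar[OF dg continuous_deriv_g g0 g1 beta_nz]) (rule that)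
    define k0 where "k0 = inverse r"
    define Z where "Z = (\<lambda>z. (z, k0)) -` (\<Omega> \<inter> (\<lambda>(z, k). (s z k, k)) -` N)"
    have "open (\<Omega> \<inter> (\<lambda>(z, k). (s z k, k)) -` N)"
      using conts by (intro continuous_open_preimage[OF _ op\<Omega> N(1)])
        (auto simp: case_prod_unfold intro!: continuous_intros)
    then have opZ: "open Z"
      unfolding Z_def by (intro open_vimage continuous_intros)
    have Z0: "0 \<in> Z" using in\<Omega> N s0 by (simp add: Z_def k0_def)
    have s\<sigma>: "s z k0 = \<sigma> (a \<bullet> node_part B z) k0" if "z \<in> Z" for z
      using that s_eq[of z k0] \<sigma>N[of "s z k0" k0] by (auto simp: Z_def)
    have \<sigma>0: "\<sigma> 0 k0 = 0" using \<sigma>N[OF N(2)] by (simp add: g0 k0_def)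
    define d where "d = inverse (1 - k0 * \<beta>)"
    have "((\<lambda>t. \<sigma> t k0) has_real_derivative d) (at (a \<bullet> node_part B 0))"
      using d\<sigma>[OF T(2)] \<sigma>0 g1 by (simp add: d_def k0_def linear_0[OF linear_node_part])
    moreover have "((\<lambda>z. a \<bullet> node_part B z) has_derivative (\<lambda>h. a \<bullet> node_part B h)) (at 0)"
      by (intro has_derivative_inner_right bounded_linear_imp_has_derivative bl)
    ultimately have "((\<lambda>z. \<sigma> (a \<bullet> node_part B z) k0) has_derivative (\<lambda>h. (a \<bullet> node_part B h) * d)) (at 0)"
      by (rule DERIV_compose_FDERIV[where f = "\<lambda>t. \<sigma> t k0"])
    then have "((\<lambda>z. s z k0) has_derivative (\<lambda>h. (a \<bullet> node_part B h) * d)) (at 0)"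
      by (rule has_derivative_transform_within_open[OF _ opZ Z0]) (simp add: s\<sigma>)
    from DERIV_compose_FDERIV[OF dg this]
    have gs: "((\<lambda>z. g (s z k0)) has_derivative (\<lambda>h. (a \<bullet> node_part B h) * d)) (at 0)"
      using s0 g1 by (simp add: k0_def)
    have AB: "bounded_linear (\<lambda>z. A (node_part B z))"
      using linear_compose[OF linear_node_part linear_A, of B] by (simp add: linear_conv_bounded_linear o_def)
    have "((\<lambda>z. A (node_part B z) - (k0 * g (s z k0)) *\<^sub>R a) has_derivative
        (\<lambda>h. A (node_part B h) - (k0 * ((a \<bullet> node_part B h) * d)) *\<^sub>R a)) (at 0)"
      by (auto intro!: derivative_eq_intros gs bounded_linear_imp_has_derivative[OF AB])
    then have "((\<lambda>z. reduced_F D R G lm B zC z 0 k0) has_derivative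
        (\<lambda>h. A (node_part B h) - (k0 * ((a \<bullet> node_part B h) * d)) *\<^sub>R a)) (at 0)"
      by (rule has_derivative_transform_within_open[OF _ opZ Z0]) (simp add: \<Phi> Z_def)
    from jacobian_matrix_mult[OF this, of z] have "jacobian_matrix (\<lambda>z. reduced_F D R G lm B zC z 0 k0) 0 *v z
        = A (node_part B z) - (k0 * ((a \<bullet> node_part B z) * d)) *\<^sub>R a" .
    \<comment> \<open>Here \<open>(1 / r) / (1 - \<beta> / r) = 1 / (r - \<beta>)\<close>.\<close>
    moreover have "k0 * d = inverse (r - \<beta>)"
      using r_pos r_neq_beta by (simp add: k0_def d_def field_simps)
    then have "k0 * ((a \<bullet> node_part B z) * d) = (a \<bullet> node_part B z) / (r - \<beta>)"
      by (simp add: divide_inverse mult.left_commute[of k0])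
    ultimately show ?thesis by (simp add: k0_def)
  qed
  have nB: "node_part B z = z" if "z \<in> ones_perp B" for z
    using that by (simp add: ones_perp_def node_part_id)
  have "rank_one_reduction (ones_perp B) (ones_perp B) A a vB g r \<beta> (reduced_F D R G lm B zC) s \<Omega>"
  proof (rule rank_one_reduction.intro)
    show "A y \<bullet> z = y \<bullet> A z" for y z by (rule A_sym)
    show "continuous_on {(z, k). (z, k) \<in> \<Omega> \<and> z \<in> ones_perp B} (\<lambda>(z, k). s z k)"
      by (rule continuous_on_subset[OF conts]) auto
    show "s z k - k * \<beta> * g (s z k) = a \<bullet> z" if "(z, k) \<in> \<Omega>" "z \<in> ones_perp B" for z k
      using s_eq[OF that(1)] nB[OF that(2)] by simp
    show "reduced_F D R G lm B zC z u k = A z - (k * g (s z k)) *\<^sub>R a - u"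
      if "(z, k) \<in> \<Omega>" "z \<in> ones_perp B" for z u k
      using \<Phi>[OF that(1)] nB[OF that(2)] by simp
    show "jacobian_matrix (\<lambda>z. reduced_F D R G lm B zC z 0 (inverse r)) 0 *v z
        = A z - (a \<bullet> z / (r - \<beta>)) *\<^sub>R a" if "z \<in> ones_perp B" for z
      using jac[of z] nB[OF that] by simp
    show "0 \<in> ones_perp B" by (simp add: subspace_ones_perp subspace_0)
    show "r \<noteq> 0" using r_pos by simp
  qed (rule subspace_ones_perp order_refl linear_A A_ones_perp A_pos vB_eq A_vB a_vB r_neq_beta
      dg dg1 dg2 g0 g1 op\<Omega> in\<Omega> s0 | assumption)+
  then show ?thesis unfolding s_def by blast
qed

end

subsection \<open>Derivatives of the two reductions\<close>

theorem theorem3: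
  fixes D :: "real^'m::finite^'n::finite"
    and R :: "'m \<Rightarrow> real"
    and G g :: "real \<Rightarrow> real"
    and lm :: 'm
    and i j :: 'n
    and B :: "'n set"
    and v :: "real^'n"
    and r :: real
  assumes "incidence_matrix D"
    and "i \<noteq> j" and "column lm D = edge_vec i j"
    and "\<And>l. l \<noteq> lm \<Longrightarrow> R l > 0"
    and "convex_on UNIV G" and "C_k_function 4 G"
    and "g = deriv G" and "g 0 = 0" and "deriv g 0 = 1"
    and "connected_without D lm"
    and "positive_laplacian D R lm *v v = edge_vec i j" and "v \<in> ones_perp UNIV"
    and "r = v $ i - v $ j"
  shows "singular_network D R G lm 0 0 (inverse r) \<and>
    {w. network_laplacian D R G lm 0 (inverse r) *v w = 0} = span {1, v} \<and>
    (block_invertible (network_laplacian D R G lm 0 (inverse r)) (- B) \<longrightarrow>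
      (\<exists>f. full_LS_reduction D R G lm B (inverse r) v f) \<and>
      (\<exists>f. reduced_LS_reduction D R G lm B (inverse r) v f) \<and>
      (\<forall>f. full_LS_reduction D R G lm B (inverse r) v f \<or>
           reduced_LS_reduction D R G lm B (inverse r) v f \<longrightarrow>
        f 0 0 (inverse r) = 0 \<and>
        ((\<lambda>x. f x 0 (inverse r)) has_real_derivative 0) (at 0) \<and>
        ((\<lambda>k. f 0 0 k) has_real_derivative 0) (at (inverse r)) \<and>
        (deriv (\<lambda>x. f x 0 (inverse r)) has_real_derivative - (deriv ^^ 2) g 0 * r\<^sup>2) (at 0) \<and>
        ((\<lambda>k. deriv (\<lambda>x. f x 0 k) 0) has_real_derivative - r\<^sup>2) (at (inverse r)) \<and>
        ((deriv ^^ 2) g 0 = 0 \<longrightarrow>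
          ((deriv ^^ 2) (\<lambda>x. f x 0 (inverse r)) has_real_derivative - (deriv ^^ 3) g 0 * r ^ 3)
            (at 0))))"
proof -
  interpret network D R G g lm i j v r B
    using assms by (intro network.intro)
  interpret full: rank_one_reduction "ones_perp UNIV" "ones_perp B" "\<lambda>z. M *v z" e v g r 0
    "network_F D R G lm" "\<lambda>z k. e \<bullet> z" UNIV
    by (rule full_rank_one_reduction)
  have "(\<exists>f. full_LS_reduction D R G lm B (inverse r) v f) \<and>
      (\<exists>f. reduced_LS_reduction D R G lm B (inverse r) v f) \<and>
      (\<forall>f. full_LS_reduction D R G lm B (inverse r) v f \<or>
           reduced_LS_reduction D R G lm B (inverse r) v f \<longrightarrow>
        reduction_derivatives g r (\<lambda>x k. f x 0 k))"
    if "block_invertible L0 (- B)"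
  proof -
    interpret reduced_network D R G g lm i j v r B
      by unfold_locales (rule that)
    \<comment> \<open>The instance is available for every central solution, so the derivatives hold
      whichever \<open>zC\<close> witnesses the reduced reduction.\<close>
    have reduced: "\<exists>s \<Omega>. rank_one_reduction (ones_perp B) (ones_perp B) A a vB g r \<beta> (reduced_F D R G lm B zC) s \<Omega>"
      if "central_solution D R G lm B (inverse r) zC" for zC
      using reduced_rank_one_reduction[OF that] by blast
    show ?thesis
      unfolding full_LS_reduction_def reduced_LS_reduction_def
      using full.LS_reduction_exists full.LS_reduction_derivatives central_solution_exists
        reduced rank_one_reduction.LS_reduction_exists rank_one_reduction.LS_reduction_derivatives
      by metis
  qed
  then show ?thesis
    using singular ker_L0 unfolding reduction_derivatives_def by blast
qed

end
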